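(* Let $n,p,J\ge 2$ be integers, let $\mathbf{x}_1,\dots,\mathbf{x}_n\in\mathbb{R}^p$ with labels $y_1,\dots,y_n\in\{1,\dots,J\}$, let $X=[\mathbf{x}_1,\dots,\mathbf{x}_n]\in\mathbb{R}^{p\times n}$, and let $c_{ij}=1$ if $y_i\neq j$ and $c_{ij}=0$ otherwise. Let $\lambda_1,\lambda_2\ge 0$ and $\lambda_3>0$. Let $\mathcal{D}=\{(W,\mathbf{b})\in\mathbb{R}^{p\times J}\times\mathbb{R}^J:\ W\mathbf{e}=\mathbf{0},\ \mathbf{e}^\top\mathbf{b}=0\}$. Problem (P1): minimize over $W,U\in\mathbb{R}^{p\times J}$, $\mathbf{b}\in\mathbb{R}^J$, $A\in\mathbb{R}^{n\times J}$ the function $$F_1(W,\mathbf{b},A,U)=\tfrac1n\sum_{i,j}c_{ij}[a_{ij}]_++\lambda_1\|U\|_1+\tfrac{\lambda_2}{2}\|W\|_F^2+\tfrac{\lambda_3}{2}\|\mathbf{b}\|_2^2$$ subject to $A=X^\top W+\mathbf{e}\mathbf{b}^\top+E$, $U=W$, $(W,\mathbf{b})\in\mathcal{D}$. Its augmented Lagrangian, for penalty parameters $\alpha,\mu>0$, is $$\mathcal{L}_1=F_1(W,\mathbf{b},A,U)+\langle \Lambda,W-U\rangle+\tfrac{\mu}{2}\|W-U\|_F^2+\langle\Pi,X^\top W+\mathbf{e}\mathbf{b}^\top-A+E\rangle+\tfrac{\alpha}{2}\|X^\top W+\mathbf{e}\mathbf{b}^\top-A+E\|_F^2 .$$ Starting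 from any initial point, the ADMM sequence $\mathbf{z}_1^{(k)}=(W^{(k)},\mathbf{b}^{(k)},A^{(k)},U^{(k)},\Pi^{(k)},\Lambda^{(k)})$ is defined by: $(W^{(k+1)},\mathbf{b}^{(k+1)})=\arg\min_{(W,\mathbf{b})\in\mathcal{D}}\mathcal{L}_1(W,\mathbf{b},A^{(k)},U^{(k)},\Pi^{(k)},\Lambda^{(k)})$; $(A^{(k+1)},U^{(k+1)})=\arg\min_{A,U}\mathcal{L}_1(W^{(k+1)},\mathbf{b}^{(k+1)},A,U,\Pi^{(k)},\Lambda^{(k)})$; $\Pi^{(k+1)}=\Pi^{(k)}+\alpha(X^\top W^{(k+1)}+\mathbf{e}(\mathbf{b}^{(k+1)})^\top-A^{(k+1)}+E)$; $\Lambda^{(k+1)}=\Lambda^{(k)}+\mu(W^{(k+1)}-U^{(k+1)})$. Problem (P2), for fixed $q\in\{2,\infty\}$: minimize over $W,U,V\in\mathbb{R}^{p\times J}$, $\mathbf{b}\in\mathbb{R}^J$, $A\in\mathbb{R}^{n\times J}$ the function $$F_2(W,\mathbf{b},A,U,V)=\tfrac1n\sum_{i,j}c_{ij}[a_{ij}]_++\lambda_1\|U\|_1+\lambda_2\sum_{j=1}^p\|\mathbf{v}^j\|_q+\tfrac{\lambda_3}{2}\|\mathbf{b}\|_2^2$$ subject to $A=X^\top W+\mathbf{e}\mathbf{b}^\top+E$, $U=W$, $V=W$, $(W,\mathbf{b})\in\mathcal{D}$. Its augmented Lagrangian, for $\alpha,\mu,\nu>0$, is $$\mathcal{L}_2=F_2+\langle\Pi,X^\top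 W+\mathbf{e}\mathbf{b}^\top-A+E\rangle+\tfrac{\alpha}{2}\|X^\top W+\mathbf{e}\mathbf{b}^\top-A+E\|_F^2+\langle\Lambda,W-U\rangle+\tfrac{\mu}{2}\|W-U\|_F^2+\langle\Gamma,W-V\rangle+\tfrac{\nu}{2}\|W-V\|_F^2 .$$ Starting from any initial point, the ADMM sequence $\mathbf{z}_2^{(k)}=(W^{(k)},\mathbf{b}^{(k)},A^{(k)},U^{(k)},V^{(k)},\Pi^{(k)},\Lambda^{(k)},\Gamma^{(k)})$ is defined by: $(W^{(k+1)},\mathbf{b}^{(k+1)})=\arg\min_{(W,\mathbf{b})\in\mathcal{D}}\mathcal{L}_2(W,\mathbf{b},A^{(k)},U^{(k)},V^{(k)},\Pi^{(k)},\Lambda^{(k)},\Gamma^{(k)})$; $(A^{(k+1)},U^{(k+1)},V^{(k+1)})=\arg\min_{A,U,V}\mathcal{L}_2(W^{(k+1)},\mathbf{b}^{(k+1)},A,U,V,\Pi^{(k)},\Lambda^{(k)},\Gamma^{(k)})$; $\Pi^{(k+1)}=\Pi^{(k)}+\alpha(X^\top W^{(k+1)}+\mathbf{e}(\mathbf{b}^{(k+1)})^\top-A^{(k+1)}+E)$; $\Lambda^{(k+1)}=\Lambda^{(k)}+\mu(W^{(k+1)}-U^{(k+1)})$; $\Gamma^{(k+1)}=\Gamma^{(k)}+\nu(W^{(k+1)}-V^{(k+1)})$. Let $F_1^{(k)}=F_1(W^{(k)},\mathbf{b}^{(k)},A^{(k)},U^{(k)})$ along $\{\mathbf{z}_1^{(k)}\}$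 and $F_2^{(k)}=F_2(W^{(k)},\mathbf{b}^{(k)},A^{(k)},U^{(k)},V^{(k)})$ along $\{\mathbf{z}_2^{(k)}\}$, and let $F_1^*,F_2^*$ be the optimal values of (P1), (P2). Then $F_1^{(k)}\to F_1^*$ and $F_2^{(k)}\to F_2^*$; along each sequence $\|X^\top W^{(k)}+\mathbf{e}(\mathbf{b}^{(k)})^\top+E-A^{(k)}\|_F\to0$ and $\|W^{(k)}-U^{(k)}\|_F\to0$; and along $\{\mathbf{z}_2^{(k)}\}$, $\|W^{(k)}-V^{(k)}\|_F\to 0$. In addition, if $\lambda_2>0$ and $\lambda_3>0$ in (P1), then $\{\mathbf{z}_1^{(k)}\}$ converges linearly.
   Context: $\mathbf{e}$ denotes an all-ones vector and $E$ an all-ones matrix of appropriate size. $[t]_+=\max(0,t)$. $\|U\|_1=\sum_{i,j}|u_{ij}|$; $\|\cdot\|_F$ is the Frobenius norm; $\langle P,Q\rangle=\operatorname{tr}(P^\top Q)$. $\mathbf{v}^j$ denotes the $j$-th row of $V$. Problems (P1) and (P2) are reformulations (via auxiliary variables $A,U,V$) of the regularized multiclass SVM $\min_{W,\mathbf{b}}\frac1n\sum_{i,j}c_{ij}[b_j+\mathbf{w}_j^\top\mathbf{x}_i+1]_++\lambda_1\|W\|_1+\lambda_2\phi(W)+\frac{\lambda_3}{2}\|\mathbf{b}\|_2^2$ s.t. $W\mathbf{e}=\mathbf{0}$, $\mathbf{e}^\top\mathbf{b}=0$, with $\phi(W)=\frac12\|W\|_F^2$ for (P1) and $\phi(W)=\sum_j\|\mathbf{w}^j\|_q$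 for (P2). *)

theory Defs
  imports "HOL-Analysis.Analysis"
begin

text \<open>Matrices are Cartesian-product types: a p x J matrix is real^'J^'p, with
  entry (i,j) given by M$i$j. The Frobenius norm is the library norm on this type,
  and the trace inner product is the library inner product.
  Index types: 'n samples, 'p features, 'J classes.\<close>

definition ones_mat :: "real ^ ('c::finite) ^ ('r::finite)" where
  "ones_mat = (\<chi> i j. 1)"

definition cost :: "(('n::finite) \<Rightarrow> ('J::finite)) \<Rightarrow> 'n \<Rightarrow> 'J \<Rightarrow> real" where
  "cost y i j = (if y i \<noteq> j then 1 else 0)"

definition pos_part :: "real \<Rightarrow> real" where
  "pos_part t = max 0 t"

definition l1_mat :: "real ^ ('c::finite) ^ ('r::finite) \<Rightarrow> real" where
  "l1_mat U = (\<Sum>i\<in>UNIV. \<Sum>j\<in>UNIV. \<bar>U $ i $ j\<bar>)"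

definition ebT :: "real ^ ('J::finite) \<Rightarrow> real ^ 'J ^ ('n::finite)" where
  "ebT b = (\<chi> i j. b $ j)"

definition Dset :: "((real ^ ('J::finite) ^ ('p::finite)) \<times> (real ^ 'J)) set" where
  "Dset = {(W, b). (\<forall>i. (\<Sum>j\<in>UNIV. W $ i $ j) = 0) \<and> (\<Sum>j\<in>UNIV. b $ j) = 0}"

definition resid :: "real ^ ('n::finite) ^ ('p::finite) \<Rightarrow> real ^ ('J::finite) ^ 'p \<Rightarrow> real ^ 'J \<Rightarrow> real ^ 'J ^ 'n \<Rightarrow> real ^ 'J ^ 'n" where
  "resid X W b A = transpose X ** W + ebT b - A + ones_mat"

definition hinge_loss :: "(('n::finite) \<Rightarrow> ('J::finite)) \<Rightarrow> real ^ 'J ^ 'n \<Rightarrow> real" where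
  "hinge_loss y A = (1 / real CARD('n)) * (\<Sum>i\<in>UNIV. \<Sum>j\<in>UNIV. cost y i j * pos_part (A $ i $ j))"

definition F1 :: "(('n::finite) \<Rightarrow> ('J::finite)) \<Rightarrow> real \<Rightarrow> real \<Rightarrow> real \<Rightarrow>
    real ^ 'J ^ ('p::finite) \<Rightarrow> real ^ 'J \<Rightarrow> real ^ 'J ^ 'n \<Rightarrow> real ^ 'J ^ 'p \<Rightarrow> real" where
  "F1 y l1 l2 l3 W b A U = hinge_loss y A + l1 * l1_mat U + (l2 / 2) * (norm W)\<^sup>2 + (l3 / 2) * (norm b)\<^sup>2"

definition L1 :: "real ^ ('n::finite) ^ ('p::finite) \<Rightarrow> ('n \<Rightarrow> ('J::finite)) \<Rightarrow> real \<Rightarrow> real \<Rightarrow> real \<Rightarrow> real \<Rightarrow> real \<Rightarrow>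
    real ^ 'J ^ 'p \<Rightarrow> real ^ 'J \<Rightarrow> real ^ 'J ^ 'n \<Rightarrow> real ^ 'J ^ 'p \<Rightarrow>
    real ^ 'J ^ 'n \<Rightarrow> real ^ 'J ^ 'p \<Rightarrow> real" where
  "L1 X y l1 l2 l3 \<alpha> \<mu> W b A U Pm Lm =
     F1 y l1 l2 l3 W b A U + inner Lm (W - U) + (\<mu> / 2) * (norm (W - U))\<^sup>2
     + inner Pm (resid X W b A) + (\<alpha> / 2) * (norm (resid X W b A))\<^sup>2"

definition lq_norm :: "ereal \<Rightarrow> real ^ ('J::finite) \<Rightarrow> real" where
  "lq_norm q v = (if q = \<infinity> then Max (range (\<lambda>j. \<bar>v $ j\<bar>))
                  else (\<Sum>j\<in>UNIV. \<bar>v $ j\<bar> powr real_of_ereal q) powr (1 / real_of_ereal q))"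

definition F2 :: "ereal \<Rightarrow> (('n::finite) \<Rightarrow> ('J::finite)) \<Rightarrow> real \<Rightarrow> real \<Rightarrow> real \<Rightarrow>
    real ^ 'J ^ ('p::finite) \<Rightarrow> real ^ 'J \<Rightarrow> real ^ 'J ^ 'n \<Rightarrow> real ^ 'J ^ 'p \<Rightarrow> real ^ 'J ^ 'p \<Rightarrow> real" where
  "F2 q y l1 l2 l3 W b A U V = hinge_loss y A + l1 * l1_mat U
     + l2 * (\<Sum>j\<in>UNIV. lq_norm q (V $ j)) + (l3 / 2) * (norm b)\<^sup>2"

definition L2 :: "ereal \<Rightarrow> real ^ ('n::finite) ^ ('p::finite) \<Rightarrow> ('n \<Rightarrow> ('J::finite)) \<Rightarrow> real \<Rightarrow> real \<Rightarrow> real \<Rightarrow>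
    real \<Rightarrow> real \<Rightarrow> real \<Rightarrow>
    real ^ 'J ^ 'p \<Rightarrow> real ^ 'J \<Rightarrow> real ^ 'J ^ 'n \<Rightarrow> real ^ 'J ^ 'p \<Rightarrow> real ^ 'J ^ 'p \<Rightarrow>
    real ^ 'J ^ 'n \<Rightarrow> real ^ 'J ^ 'p \<Rightarrow> real ^ 'J ^ 'p \<Rightarrow> real" where
  "L2 q X y l1 l2 l3 \<alpha> \<mu> \<nu> W b A U V Pm Lm Gm =
     F2 q y l1 l2 l3 W b A U V
     + inner Pm (resid X W b A) + (\<alpha> / 2) * (norm (resid X W b A))\<^sup>2
     + inner Lm (W - U) + (\<mu> / 2) * (norm (W - U))\<^sup>2
     + inner Gm (W - V) + (\<nu> / 2) * (norm (W - V))\<^sup>2"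

definition opt1 :: "real ^ ('n::finite) ^ ('p::finite) \<Rightarrow> ('n \<Rightarrow> ('J::finite)) \<Rightarrow> real \<Rightarrow> real \<Rightarrow> real \<Rightarrow> real" where
  "opt1 X y l1 l2 l3 = Inf {F1 y l1 l2 l3 W b A U | W b A U.
      A = transpose X ** W + ebT b + ones_mat \<and> U = W \<and> (W, b) \<in> Dset}"

definition opt2 :: "ereal \<Rightarrow> real ^ ('n::finite) ^ ('p::finite) \<Rightarrow> ('n \<Rightarrow> ('J::finite)) \<Rightarrow> real \<Rightarrow> real \<Rightarrow> real \<Rightarrow> real" where
  "opt2 q X y l1 l2 l3 = Inf {F2 q y l1 l2 l3 W b A U V | W b A U V.
      A = transpose X ** W + ebT b + ones_mat \<and> U = W \<and> V = W \<and> (W, b) \<in> Dset}"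

end

theory Submission
  imports Defs
begin

text \<open>
  Rescaling the split variables turns both problems into: minimise \<open>f x + g w\<close> subject to
  \<open>w = M x + c\<close> and \<open>x \<in> S\<close>, with penalty parameter one. In terms of \<open>s = w + l\<close>, where \<open>l\<close> is the
  multiplier, ADMM is the Douglas--Rachford iteration, so \<open>s\<close> is Fejer monotone with respect to
  \<open>M x\<^sup>* + c + l\<^sup>*\<close> for every saddle point \<open>(x\<^sup>*, l\<^sup>*)\<close>; hence its increments vanish, and with them the
  residuals and the gap in the objective. A saddle point exists by a separating hyperplane once the
  minimum is attained. Attainment is not a matter of coercivity when \<open>\<lambda>\<^sub>1 = \<lambda>\<^sub>2 = 0\<close>; there a
  Hoffman-type lemma replaces every feasible point by one that is no worse and is bounded in terms of its
  hinge loss.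

  For the linear rate, \<open>f\<close> is quadratic and \<open>g\<close> is separable and piecewise linear, so the optimality
  conditions are linear equations on a finite union of boxes. The same Hoffman-type lemma bounds the
  distance of \<open>s\<close> to the solution set by a multiple of its increment, and together with Fejer
  monotonicity this makes that distance contract by a constant factor.
\<close>

section \<open>Hoffman-type bounds for boxes\<close>

text \<open>In the abstract setting neither minimisers nor multipliers need be unique. The rate is
  therefore proved for the distance to a set, and the limit point is identified only afterwards,
  from the decay of that distance.

  The Hoffman-type lemma asks for a correction \<open>v\<close> that lies coordinatewise between 0
  and \<open>d\<close>. Moving from \<open>z\<close> by such a correction of \<open>z - z0\<close>
  stays between \<open>z\<close> and \<open>z0\<close>, hence inside every box that contains both.
  The same property keeps nonnegative variables nonnegative. The attainment argument relies on this:
  it splits the margins into positive and negative parts, and the loss gives no control over the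
  negative ones.

  The initial point is arbitrary, so \<open>l 0\<close> need not be a subgradient of
  \<open>g\<close> at \<open>y 0\<close>. The first update restores this relation, and the estimates
  start at index one.

  The rate concerns (P1), where the squared norm of \<open>W\<close> sits in \<open>f\<close> and
  leaves a piecewise linear \<open>g\<close>. In (P2) the row norms belong to \<open>g\<close>, and
  for \<open>q = 2\<close> they are not piecewise linear.\<close>

lemma closed_cone_linear_bound:
  fixes L :: "'a::euclidean_space \<Rightarrow> 'b::real_normed_vector"
  assumes L: "linear L" and C: "closed C"
    and scale: "\<And>t w. t \<ge> 0 \<Longrightarrow> w \<in> C \<Longrightarrow> t *\<^sub>R w \<in> C"
    and ker: "\<And>w. w \<in> C \<Longrightarrow> L w = 0 \<Longrightarrow> w = 0"
  shows "\<exists>K\<ge>0. \<forall>w\<in>C. norm w \<le> K * norm (L w)"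
proof (cases "C \<inter> sphere 0 1 = {}")
  case True
  have "w = 0" if "w \<in> C" for w
  proof (rule ccontr)
    assume "w \<noteq> 0"
    then have "(1 / norm w) *\<^sub>R w \<in> C \<inter> sphere 0 1"
      using scale[of "1 / norm w" w] that by auto
    with True show False by blast
  qed
  then show ?thesis by (intro exI[of _ 0]) auto
next
  case False
  have "compact (C \<inter> sphere 0 1)" using C by (simp add: closed_Int_compact)
  moreover have "continuous_on (C \<inter> sphere 0 1) (\<lambda>w. norm (L w))"
    by (intro continuous_intros linear_continuous_on) (use L in \<open>simp add: linear_conv_bounded_linear\<close>)
  ultimately obtain w0 where "w0 \<in> C \<inter> sphere 0 1"
    and "\<forall>w\<in>C \<inter> sphere 0 1. norm (L w0) \<le> norm (L w)"
    using False continuous_attains_inf by blast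
  then have w0: "w0 \<in> C" "norm w0 = 1"
    and min: "\<And>w. w \<in> C \<Longrightarrow> norm w = 1 \<Longrightarrow> norm (L w0) \<le> norm (L w)" by auto
  have pos: "norm (L w0) > 0" using ker[of w0] w0 by fastforce
  have "norm w \<le> (1 / norm (L w0)) * norm (L w)" if "w \<in> C" for w
  proof (cases "w = 0")
    case False
    have "norm (L w0) \<le> norm (L ((1 / norm w) *\<^sub>R w))"
      using scale[of "1 / norm w" w] that False by (intro min) auto
    also have "\<dots> = norm (L w) / norm w"
      by (simp add: linear_cmul[OF L])
    finally show ?thesis using False pos by (simp add: field_simps)
  qed simp
  then show ?thesis using pos by (intro exI[of _ "1 / norm (L w0)"]) auto
qed

text \<open>A Hoffman-type bound that only shrinks coordinates towards zero. A minimiser of the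
  \<open>\<ell>\<^sub>1\<close>-norm in the box spanned by \<open>0\<close> and \<open>d\<close> cannot be shortened along the kernel of \<open>L\<close>, so the
  kernel meets its closed sign cone only in \<open>0\<close>; there are finitely many sign cones.\<close>

lemma coordinatewise_Hoffman:
  fixes L :: "'a::euclidean_space \<Rightarrow> 'b::real_normed_vector"
  assumes L: "linear L"
  obtains K where "K \<ge> 0"
    "\<And>d. \<exists>v. (\<forall>b\<in>Basis. min 0 (d \<bullet> b) \<le> v \<bullet> b \<and> v \<bullet> b \<le> max 0 (d \<bullet> b)) \<and> L v = L d \<and>
            norm v \<le> K * norm (L d)"
proof -
  \<comment> \<open>The pair records where a coordinate may be positive and where it may be
    negative. Outside both sets it vanishes, so support and signs are encoded together.\<close>
  define C :: "'a set \<times> 'a set \<Rightarrow> 'a set" where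
    "C = (\<lambda>(I, J). {w. \<forall>b\<in>Basis. (b \<notin> I \<longrightarrow> w \<bullet> b \<le> 0) \<and> (b \<notin> J \<longrightarrow> w \<bullet> b \<ge> 0)})"
  define good where "good = (\<lambda>P. \<forall>w\<in>C P. L w = 0 \<longrightarrow> w = 0)"
  have Ccl: "closed (C P)" for P
    unfolding C_def Ball_def
    by (cases P) (auto intro!: closed_Collect_all closed_Collect_imp closed_Collect_conj closed_Collect_le
        continuous_intros open_Collect_const)
  have "\<exists>K\<ge>0. good P \<longrightarrow> (\<forall>w\<in>C P. norm w \<le> K * norm (L w))" for P
  proof (cases "good P")
    case True
    have "t *\<^sub>R w \<in> C P" if "t \<ge> 0" "w \<in> C P" for t w
      using that unfolding C_def by (cases P) (auto simp: mult_nonneg_nonpos)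
    then show ?thesis
      using closed_cone_linear_bound[OF L Ccl] True unfolding good_def by blast
  qed auto
  then obtain k where k0: "\<And>P. k P \<ge> 0"
    and k: "\<And>P w. good P \<Longrightarrow> w \<in> C P \<Longrightarrow> norm w \<le> k P * norm (L w)" by metis
  define \<P> where "\<P> = Pow (Basis :: 'a set) \<times> Pow (Basis :: 'a set)"
  have fin: "finite \<P>" unfolding \<P>_def by simp
  \<comment> \<open>The sum over all sign cones dominates the constant of each, so one
    \<open>K\<close> serves every \<open>d\<close>.\<close>
  define K where "K = sum k \<P>"
  show thesis
  proof (rule that)
    show "K \<ge> 0" unfolding K_def by (simp add: k0 sum_nonneg)
    fix d :: 'a
    define B where "B = {v. (\<forall>b\<in>Basis. min 0 (d \<bullet> b) \<le> v \<bullet> b \<and> v \<bullet> b \<le> max 0 (d \<bullet> b))}"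
    have "B = cbox (\<Sum>b\<in>Basis. min 0 (d \<bullet> b) *\<^sub>R b) (\<Sum>b\<in>Basis. max 0 (d \<bullet> b) *\<^sub>R b)"
      unfolding B_def by (auto simp: mem_box)
    then have "compact B" by simp
    moreover have "closed {v. L v = L d}"
      using linear_continuous_on[of L UNIV] L
      by (intro closed_Collect_eq continuous_intros) (auto simp: linear_conv_bounded_linear)
    ultimately have "compact (B \<inter> {v. L v = L d})" by (rule compact_Int_closed)
    moreover have "d \<in> B \<inter> {v. L v = L d}" unfolding B_def by auto
    moreover have "continuous_on (B \<inter> {v. L v = L d}) (\<lambda>v. \<Sum>b\<in>Basis. \<bar>v \<bullet> b\<bar>)"
      by (intro continuous_intros)
    ultimately obtain v where "v \<in> B \<inter> {v. L v = L d}"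
      and "\<forall>w\<in>B \<inter> {v. L v = L d}. (\<Sum>b\<in>Basis. \<bar>v \<bullet> b\<bar>) \<le> (\<Sum>b\<in>Basis. \<bar>w \<bullet> b\<bar>)"
      using continuous_attains_inf[of "B \<inter> {v. L v = L d}"] by blast
    then have vB: "v \<in> B" and Lv: "L v = L d"
      and vmin: "\<And>w. w \<in> B \<Longrightarrow> L w = L d \<Longrightarrow> (\<Sum>b\<in>Basis. \<bar>v \<bullet> b\<bar>) \<le> (\<Sum>b\<in>Basis. \<bar>w \<bullet> b\<bar>)"
      by auto
    define P where "P = ({b\<in>Basis. v \<bullet> b > 0}, {b\<in>Basis. v \<bullet> b < 0})"
    have "good P"
      unfolding good_def
    proof (intro ballI impI, rule ccontr)
      fix w assume w: "w \<in> C P" "L w = 0" "w \<noteq> 0"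
      have wpos: "w \<bullet> b \<ge> 0" if "v \<bullet> b > 0" "b \<in> Basis" for b
        using w(1) that unfolding C_def P_def by auto
      have wneg: "w \<bullet> b \<le> 0" if "v \<bullet> b < 0" "b \<in> Basis" for b
        using w(1) that unfolding C_def P_def by auto
      have wzero: "w \<bullet> b = 0" if "v \<bullet> b = 0" "b \<in> Basis" for b
        using w(1) that unfolding C_def P_def by fastforce
      \<comment> \<open>Ratio test: with the step \<open>Min N / norm w\<close> no nonzero
        coordinate of \<open>v\<close> changes sign. Hence \<open>v - t *\<^sub>R w\<close> stays in
        the box, and each modulus drops by exactly
        \<open>t * \<bar>w \<bullet> b\<bar>\<close>.\<close>
      define N where "N = (\<lambda>b. \<bar>v \<bullet> b\<bar>) ` {b\<in>Basis. v \<bullet> b \<noteq> 0}"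
      obtain b0 where b0: "b0 \<in> Basis" "w \<bullet> b0 \<noteq> 0" using w(3) euclidean_all_zero_iff by blast
      then have N: "finite N" "N \<noteq> {}" using wzero unfolding N_def by auto
      have Npos: "Min N > 0" using N unfolding N_def by (subst Min_gr_iff) auto
      define t where "t = Min N / norm w"
      have tpos: "t > 0" unfolding t_def using Npos w(3) by simp
      have small: "t * \<bar>w \<bullet> b\<bar> \<le> \<bar>v \<bullet> b\<bar>" if "b \<in> Basis" for b
      proof (cases "v \<bullet> b = 0")
        case False
        have "t * \<bar>w \<bullet> b\<bar> \<le> t * norm w" using tpos Basis_le_norm[OF that, of w] by simp
        also have "\<dots> = Min N" unfolding t_def using w(3) by simp
        also have "\<dots> \<le> \<bar>v \<bullet> b\<bar>" using N(1) False that unfolding N_def by (intro Min_le) auto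
        finally show ?thesis .
      qed (use that wzero in simp)
      have coord: "\<bar>(v - t *\<^sub>R w) \<bullet> b\<bar> = \<bar>v \<bullet> b\<bar> - t * \<bar>w \<bullet> b\<bar> \<and>
          min 0 (v \<bullet> b) \<le> (v - t *\<^sub>R w) \<bullet> b \<and> (v - t *\<^sub>R w) \<bullet> b \<le> max 0 (v \<bullet> b)"
        if b: "b \<in> Basis" for b
      proof -
        consider "v \<bullet> b > 0" | "v \<bullet> b < 0" | "v \<bullet> b = 0" by linarith
        then show ?thesis
        proof cases
          case 1
          have "0 \<le> t * (w \<bullet> b)" using wpos[OF 1 b] tpos by simp
          then show ?thesis using 1 small[OF b] wpos[OF 1 b] by (simp add: inner_diff_left)
        next
          case 2
          have "t * (w \<bullet> b) \<le> 0" using wneg[OF 2 b] tpos by (simp add: mult_nonneg_nonpos)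
          then show ?thesis using 2 small[OF b] wneg[OF 2 b] by (simp add: inner_diff_left)
        next
          case 3
          then show ?thesis using wzero[OF 3 b] by (simp add: inner_diff_left)
        qed
      qed
      have "v - t *\<^sub>R w \<in> B"
        using coord vB unfolding B_def by (smt (verit, best) mem_Collect_eq)
      moreover have "L (v - t *\<^sub>R w) = L d"
        using Lv w(2) by (simp add: linear_diff[OF L] linear_cmul[OF L])
      ultimately have "(\<Sum>b\<in>Basis. \<bar>v \<bullet> b\<bar>) \<le> (\<Sum>b\<in>Basis. \<bar>(v - t *\<^sub>R w) \<bullet> b\<bar>)" by (rule vmin)
      also have "\<dots> = (\<Sum>b\<in>Basis. \<bar>v \<bullet> b\<bar> - t * \<bar>w \<bullet> b\<bar>)" using coord by (intro sum.cong) auto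
      also have "\<dots> < (\<Sum>b\<in>Basis. \<bar>v \<bullet> b\<bar>)"
        using tpos b0 by (intro sum_strict_mono_ex1) (auto intro!: bexI[of _ b0])
      finally show False by simp
    qed
    moreover have "v \<in> C P" unfolding C_def P_def by auto
    ultimately have "norm v \<le> k P * norm (L d)" using k Lv by metis
    also have "k P \<le> K" unfolding K_def using fin k0
      by (intro member_le_sum) (auto simp: \<P>_def P_def)
    finally have "norm v \<le> K * norm (L d)" by (simp add: mult_right_mono)
    then show "\<exists>v. (\<forall>b\<in>Basis. min 0 (d \<bullet> b) \<le> v \<bullet> b \<and> v \<bullet> b \<le> max 0 (d \<bullet> b)) \<and> L v = L d \<and>
            norm v \<le> K * norm (L d)"
      using vB Lv unfolding B_def by auto
  qed
qed

section \<open>Variational inequalities and multipliers\<close>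

text \<open>On the segment from \<open>x\<close> to \<open>z\<close> convexity bounds the change of
  \<open>f\<close> by a multiple of \<open>t\<close>, while the square changes by a linear term plus
  one of order \<open>t\<close> squared. Dividing by \<open>t\<close> and making it small leaves the
  inequality, with no differentiability of \<open>f\<close>.\<close>

lemma convex_least_squares_variational:
  fixes M :: "'a::real_vector \<Rightarrow> 'b::real_inner"
  assumes M: "linear M" and S: "convex S" and f: "convex_on S f" and xS: "x \<in> S" and zS: "z \<in> S"
    and min: "\<And>z. z \<in> S \<Longrightarrow> f x + (1/2) * (norm (M x + c))\<^sup>2 \<le> f z + (1/2) * (norm (M z + c))\<^sup>2"
  shows "0 \<le> f z - f x + (M x + c) \<bullet> M (z - x)"
proof (rule ccontr)
  define A where "A = f z - f x + (M x + c) \<bullet> M (z - x)"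
  define N where "N = (norm (M (z - x)))\<^sup>2"
  assume "\<not> 0 \<le> f z - f x + (M x + c) \<bullet> M (z - x)"
  then have A: "A < 0" by (simp add: A_def)
  have N: "N \<ge> 0" by (simp add: N_def)
  have key: "0 \<le> A + t / 2 * N" if t: "0 < t" "t < 1" for t
  proof -
    have pt: "(1 - t) *\<^sub>R x + t *\<^sub>R z = x + t *\<^sub>R (z - x)" by (simp add: algebra_simps)
    have inS: "x + t *\<^sub>R (z - x) \<in> S"
      using convexD_alt[OF S xS zS, of t] t pt by simp
    have "f (x + t *\<^sub>R (z - x)) \<le> (1 - t) * f x + t * f z"
      using convex_onD[OF f, of t x z] t xS zS pt by simp
    moreover have "(norm (M (x + t *\<^sub>R (z - x)) + c))\<^sup>2
        = (norm (M x + c))\<^sup>2 + 2 * t * ((M x + c) \<bullet> M (z - x)) + t\<^sup>2 * N"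
    proof -
      have "M (x + t *\<^sub>R (z - x)) + c = (M x + c) + t *\<^sub>R M (z - x)"
        by (simp add: linear_add[OF M] linear_cmul[OF M])
      then show ?thesis
        unfolding N_def power2_norm_eq_inner
        by (simp add: inner_add_left inner_add_right inner_commute algebra_simps power2_eq_square)
    qed
    moreover note min[OF inS]
    ultimately have "0 \<le> t * A + t\<^sup>2 / 2 * N" by (simp add: A_def algebra_simps)
    then have "0 \<le> t * (A + t / 2 * N)" by (simp add: algebra_simps power2_eq_square)
    then show ?thesis using t by (simp add: zero_le_mult_iff)
  qed
  \<comment> \<open>This choice makes \<open>t * N\<close> at most \<open>- A\<close>, so
    \<open>A + t / 2 * N\<close> is at most \<open>A / 2\<close>; the added 1 guards against
    \<open>N = 0\<close>.\<close>
  define t where "t = min (1/2) (- A / (N + 1))"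
  have t: "0 < t" "t < 1" using A N by (auto simp: t_def divide_neg_pos)
  have "t * N \<le> (- A / (N + 1)) * N" using N by (intro mult_right_mono) (auto simp: t_def)
  also have "\<dots> = (- A) * (N / (N + 1))" by simp
  also have "\<dots> \<le> (- A) * 1" using A N by (intro mult_left_mono) auto
  finally have "A + t / 2 * N < 0" using A by (simp add: algebra_simps)
  with key[OF t] show False by linarith
qed

text \<open>Fenchel duality: the strict epigraph of \<open>g\<close> is separated from the points
  that lie at or below height \<open>p - f z\<close> over some \<open>M z + c\<close> with
  \<open>z\<close> in \<open>S\<close>. Optimality of \<open>x\<close> makes the two sets disjoint,
  and the slope of the hyperplane is the multiplier.\<close>

lemma composite_multiplier_exists:
  fixes M :: "'a::euclidean_space \<Rightarrow> 'b::euclidean_space"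
  assumes M: "linear M" and S: "convex S" and f: "convex_on S f" and g: "convex_on UNIV g"
    and xS: "x \<in> S" and min: "\<And>z. z \<in> S \<Longrightarrow> f x + g (M x + c) \<le> f z + g (M z + c)"
  obtains l where "\<And>z. z \<in> S \<Longrightarrow> f x + l \<bullet> M x \<le> f z + l \<bullet> M z"
    and "\<And>w. g (M x + c) + l \<bullet> (w - (M x + c)) \<le> g w"
proof -
  define p where "p = f x + g (M x + c)"
  define C1 where "C1 = {v. g (fst v) < snd v}"
  define C2 where "C2 = {v. \<exists>z\<in>S. fst v = M z + c \<and> snd v \<le> p - f z}"
  have gD: "g ((1 - t) *\<^sub>R u + t *\<^sub>R v) \<le> (1 - t) * g u + t * g v" if "0 \<le> t" "t \<le> 1" for t u v
    using convex_onD[OF g that] by simp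
  have "convex C1"
    unfolding convex_alt C1_def
  proof (clarsimp)
    fix a s b r and u :: real
    assume h: "g a < s" "g b < r" "0 \<le> u" "u \<le> 1"
    have "g ((1 - u) *\<^sub>R a + u *\<^sub>R b) \<le> (1 - u) * g a + u * g b" using gD h by simp
    also have "\<dots> < (1 - u) * s + u * r"
    proof (cases "u = 0")
      case False
      then have "u * g b < u * r" using h by simp
      moreover have "(1 - u) * g a \<le> (1 - u) * s" using h by (intro mult_left_mono) auto
      ultimately show ?thesis by simp
    qed (use h in simp)
    finally show "g ((1 - u) *\<^sub>R a + u *\<^sub>R b) < (1 - u) * s + u * r" .
  qed
  moreover have "convex C2"
    unfolding convex_alt C2_def
  proof (clarsimp)
    fix s r u :: real and z w
    assume h: "z \<in> S" "s \<le> p - f z" "w \<in> S" "r \<le> p - f w" "0 \<le> u" "u \<le> 1"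
    let ?y = "(1 - u) *\<^sub>R z + u *\<^sub>R w"
    have "?y \<in> S" using convexD_alt[OF S] h by auto
    moreover have "(1 - u) *\<^sub>R (M z + c) + u *\<^sub>R (M w + c) = M ?y + c"
      by (simp add: linear_add[OF M] linear_cmul[OF M] linear_diff[OF M] scaleR_add_right scaleR_left_diff_distrib)
    moreover have "(1 - u) * s + u * r \<le> p - f ?y"
    proof -
      have "f ?y \<le> (1 - u) * f z + u * f w" using convex_onD[OF f] h by simp
      moreover have "(1 - u) * s \<le> (1 - u) * (p - f z)" using h by (intro mult_left_mono) auto
      moreover have "u * r \<le> u * (p - f w)" using h by (intro mult_left_mono) auto
      ultimately show ?thesis by (simp add: algebra_simps)
    qed
    ultimately show "\<exists>y\<in>S. (1 - u) *\<^sub>R (M z + c) + u *\<^sub>R (M w + c) = M y + c \<and>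
        (1 - u) * s + u * r \<le> p - f y" by blast
  qed
  moreover have "(0, g 0 + 1) \<in> C1" unfolding C1_def by simp
  moreover have "(M x + c, p - f x) \<in> C2" unfolding C2_def using xS by auto
  moreover have "C1 \<inter> C2 = {}"
  proof -
    have False if h: "g u < t" "z \<in> S" "u = M z + c" "t \<le> p - f z" for u t z
      using min[OF h(2)] h unfolding p_def by auto
    then show ?thesis unfolding C1_def C2_def by fastforce
  qed
  ultimately obtain v \<gamma> where v: "v \<noteq> 0" and v2: "\<And>w. w \<in> C2 \<Longrightarrow> v \<bullet> w \<le> \<gamma>"
    and v1: "\<And>w. w \<in> C1 \<Longrightarrow> \<gamma> \<le> v \<bullet> w"
    using separating_hyperplane_sets[of C2 C1] by blast
  obtain a \<beta> where ab: "v = (a, \<beta>)" by (cases v)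
  have h1: "\<gamma> \<le> a \<bullet> w + \<beta> * t" if "g w < t" for w t
    using v1[of "(w, t)"] that by (simp add: C1_def ab)
  have h2: "a \<bullet> (M z + c) + \<beta> * (p - f z) \<le> \<gamma>" if "z \<in> S" for z
    using v2[of "(M z + c, p - f z)"] that by (auto simp: C2_def ab)
  have "\<beta> \<ge> 0"
  proof (rule ccontr)
    assume "\<not> \<beta> \<ge> 0"
    then have neg: "\<beta> < 0" by simp
    define t where "t = max (g 0 + 1) (\<gamma> / \<beta> + 1)"
    have "\<beta> * t \<le> \<beta> * (\<gamma> / \<beta> + 1)" using neg by (intro mult_left_mono_neg) (auto simp: t_def)
    also have "\<dots> = \<gamma> + \<beta>" using neg by (simp add: algebra_simps)
    finally have "\<beta> * t < \<gamma>" using neg by simp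
    moreover have "g 0 < t" by (simp add: t_def)
    ultimately show False using h1[of 0 t] by simp
  qed
  \<comment> \<open>A vertical hyperplane would bound a nonzero linear functional below on the whole
    space, because \<open>g\<close> is finite everywhere. This stands in for a constraint
    qualification.\<close>
  moreover have "\<beta> \<noteq> 0"
  proof
    assume b0: "\<beta> = 0"
    then have "a \<noteq> 0" using v ab by (auto simp: zero_prod_def)
    then have "a \<bullet> a > 0" by simp
    have "\<gamma> \<le> a \<bullet> w" for w using h1[of w "g w + 1"] b0 by simp
    from this[of "((\<gamma> - 1) / (a \<bullet> a)) *\<^sub>R a"] show False using \<open>a \<bullet> a > 0\<close> by simp
  qed
  ultimately have \<beta>: "\<beta> > 0" by simp
  \<comment> \<open>The strict epigraph omits the graph of \<open>g\<close>; letting the slack tend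
    to zero recovers it.\<close>
  have h1': "\<gamma> \<le> a \<bullet> w + \<beta> * g w" for w
  proof (rule field_le_epsilon)
    fix e :: real assume "e > 0"
    then show "\<gamma> \<le> a \<bullet> w + \<beta> * g w + e"
      using h1[of w "g w + e / \<beta>"] \<beta> by (simp add: algebra_simps)
  qed
  have eq: "\<gamma> = a \<bullet> (M x + c) + \<beta> * g (M x + c)"
    using h1'[of "M x + c"] h2[OF xS] by (simp add: p_def)
  define l where "l = - (1 / \<beta>) *\<^sub>R a"
  have al: "a = - \<beta> *\<^sub>R l" using \<beta> by (simp add: l_def)
  show thesis
  proof (rule that)
    fix z assume "z \<in> S"
    have "\<beta> * (f x + l \<bullet> M x) \<le> \<beta> * (f z + l \<bullet> M z)"
      using h2[OF \<open>z \<in> S\<close>] unfolding eq al p_def by (simp add: algebra_simps inner_add_right)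
    then show "f x + l \<bullet> M x \<le> f z + l \<bullet> M z" using \<beta> by simp
  next
    fix w
    have "\<beta> * (g (M x + c) + l \<bullet> (w - (M x + c))) \<le> \<beta> * g w"
      using h1'[of w] unfolding eq al by (simp add: algebra_simps inner_diff_right inner_add_right)
    then show "g (M x + c) + l \<bullet> (w - (M x + c)) \<le> g w" using \<beta> by simp
  qed
qed

section \<open>Convergence of ADMM\<close>

text \<open>\<open>l\<close> is the scaled multiplier: for a residual \<open>r\<close>, the term
  \<open>l \<bullet> r\<close> and half the square of \<open>norm r\<close> merge into half the
  square of \<open>norm (r + l)\<close>, up to a term free of the primal variables. Nothing is
  assumed about \<open>x 0\<close>, \<open>y 0\<close> and \<open>l 0\<close>.\<close>

locale admm =
  fixes M :: "'a::euclidean_space \<Rightarrow> 'b::euclidean_space" and c :: 'b and S :: "'a set"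
    and f :: "'a \<Rightarrow> real" and g :: "'b \<Rightarrow> real"
    and x :: "nat \<Rightarrow> 'a" and y l :: "nat \<Rightarrow> 'b"
  assumes linear_M: "linear M" and convex_S: "convex S"
    and convex_f: "convex_on S f" and convex_g: "convex_on UNIV g"
    and x_mem: "\<And>k. x (Suc k) \<in> S"
    and x_min: "\<And>k z. z \<in> S \<Longrightarrow>
      f (x (Suc k)) + (1/2) * (norm (M (x (Suc k)) + c - y k + l k))\<^sup>2
        \<le> f z + (1/2) * (norm (M z + c - y k + l k))\<^sup>2"
    and y_min: "\<And>k w.
      g (y (Suc k)) + (1/2) * (norm (M (x (Suc k)) + c - y (Suc k) + l k))\<^sup>2
        \<le> g w + (1/2) * (norm (M (x (Suc k)) + c - w + l k))\<^sup>2"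
    and l_step: "\<And>k. l (Suc k) = l k + (M (x (Suc k)) + c - y (Suc k))"
begin

text \<open>The optimality conditions with the split variable eliminated: \<open>xs\<close>
  minimises the Lagrangian over \<open>S\<close>, and \<open>ls\<close> is a subgradient of
  \<open>g\<close> at \<open>M xs + c\<close>.\<close>

definition saddle :: "'a \<Rightarrow> 'b \<Rightarrow> bool" where
  "saddle xs ls \<longleftrightarrow> xs \<in> S \<and> (\<forall>z\<in>S. f xs + ls \<bullet> M xs \<le> f z + ls \<bullet> M z) \<and>
     (\<forall>w. g (M xs + c) + ls \<bullet> (w - (M xs + c)) \<le> g w)"

lemma saddle_exists:
  assumes xs: "xs \<in> S" and min: "\<And>z. z \<in> S \<Longrightarrow> f xs + g (M xs + c) \<le> f z + g (M z + c)"
  shows "\<exists>ls. saddle xs ls"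
proof -
  obtain ls where "\<And>z. z \<in> S \<Longrightarrow> f xs + ls \<bullet> M xs \<le> f z + ls \<bullet> M z"
    and "\<And>w. g (M xs + c) + ls \<bullet> (w - (M xs + c)) \<le> g w"
    using composite_multiplier_exists[OF linear_M convex_S convex_f convex_g assms] by blast
  then show ?thesis using xs unfolding saddle_def by blast
qed

text \<open>The Douglas--Rachford governing sequence hidden in the iteration.\<close>

definition s :: "nat \<Rightarrow> 'b" where
  "s k = y k + l k"

lemma s_Suc: "s (Suc k) = M (x (Suc k)) + c + l k"
  by (simp add: s_def l_step)

text \<open>The step uses the old \<open>y k\<close>, so the vector paired with the direction equals
  \<open>l (Suc k) + (y (Suc k) - y k)\<close>. The lag in \<open>y\<close> is the error that later
  has to vanish.\<close>

lemma x_variational: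
  assumes "z \<in> S"
  shows "0 \<le> f z - f (x (Suc k)) + (M (x (Suc k)) + c - y k + l k) \<bullet> (M z - M (x (Suc k)))"
proof -
  have "0 \<le> f z - f (x (Suc k)) + (M (x (Suc k)) + (c - y k + l k)) \<bullet> M (z - x (Suc k))"
    by (rule convex_least_squares_variational[OF linear_M convex_S convex_f x_mem assms])
      (use x_min in \<open>simp add: algebra_simps\<close>)
  then show ?thesis by (simp add: linear_diff[OF linear_M] algebra_simps)
qed

text \<open>The multiplier update is designed for this: the gradient of the square at
  \<open>y (Suc k)\<close> is \<open>- l (Suc k)\<close>, so the new multiplier is an exact
  subgradient of \<open>g\<close> at the new \<open>y\<close>.\<close>

lemma y_variational: "g (y (Suc k)) + l (Suc k) \<bullet> (w - y (Suc k)) \<le> g w"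
proof -
  let ?d = "- (M (x (Suc k)) + c + l k)"
  have sq: "(norm (M (x (Suc k)) + c - v + l k))\<^sup>2 = (norm (v + ?d))\<^sup>2" for v
    by (subst norm_minus_cancel[symmetric]) (simp add: algebra_simps)
  have "0 \<le> g w - g (y (Suc k)) + (y (Suc k) + ?d) \<bullet> (w - y (Suc k))"
    by (rule convex_least_squares_variational[of "\<lambda>v. v", OF linear_id[unfolded id_def] convex_UNIV convex_g])
      (use y_min[of k] in \<open>simp_all add: sq\<close>)
  moreover have "y (Suc k) + ?d = - l (Suc k)" by (simp add: l_step)
  ultimately show ?thesis by (simp add: inner_diff_right)
qed

text \<open>Firm nonexpansiveness. One Douglas--Rachford step joins the \<open>y\<close> and
  \<open>l\<close> of one index with the \<open>x\<close> of the next. Monotonicity of the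
  subdifferential of \<open>g\<close> gives the first inequality, the \<open>x\<close> step compared
  with the saddle point gives the second, and the drop in squared distances is exactly twice their
  combined slack.\<close>

lemma s_Fejer:
  assumes "saddle xs ls"
  shows "(norm (s (Suc (Suc k)) - (M xs + c + ls)))\<^sup>2 + (norm (s (Suc (Suc k)) - s (Suc k)))\<^sup>2
    \<le> (norm (s (Suc k) - (M xs + c + ls)))\<^sup>2"
proof -
  define a where "a = l (Suc k) - ls"
  define b where "b = y (Suc k) - (M xs + c)"
  define d where "d = M (x (Suc (Suc k))) + c - (M xs + c)"
  have xs: "xs \<in> S" using assms by (simp add: saddle_def)
  have "g (M xs + c) + ls \<bullet> b \<le> g (y (Suc k))"
    using assms unfolding saddle_def b_def by blast
  moreover have "g (y (Suc k)) - l (Suc k) \<bullet> b \<le> g (M xs + c)"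
    using y_variational[of k "M xs + c"] by (simp add: b_def inner_diff_right algebra_simps)
  ultimately have 1: "0 \<le> a \<bullet> b" by (simp add: a_def inner_diff_left)
  have "0 \<le> f xs - f (x (Suc (Suc k))) - (d - b + l (Suc k)) \<bullet> d"
    using x_variational[OF xs, of "Suc k"] by (simp add: b_def d_def inner_diff_right algebra_simps)
  moreover have "f xs \<le> f (x (Suc (Suc k))) + ls \<bullet> d"
    using assms x_mem[of "Suc k"] by (auto simp: saddle_def d_def inner_diff_right algebra_simps)
  ultimately have 2: "(d - b + a) \<bullet> d \<le> 0"
    by (simp add: a_def inner_diff_left inner_add_left algebra_simps)
  have e: "s (Suc (Suc k)) - (M xs + c + ls) = d + a" "s (Suc k) - (M xs + c + ls) = a + b"
    "s (Suc (Suc k)) - s (Suc k) = d - b"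
    by (simp_all add: s_Suc[of "Suc k"] s_def[of "Suc k"] a_def b_def d_def)
  have "(norm (a + b))\<^sup>2 - ((norm (d + a))\<^sup>2 + (norm (d - b))\<^sup>2) = 2 * (a \<bullet> b - (d - b + a) \<bullet> d)"
    unfolding power2_norm_eq_inner
    by (simp add: inner_add_left inner_add_right inner_diff_left inner_diff_right inner_commute)
  moreover have "0 \<le> 2 * (a \<bullet> b - (d - b + a) \<bullet> d)" using 1 2 by simp
  ultimately show ?thesis unfolding e by (metis diff_ge_0_iff_ge)
qed

text \<open>Since \<open>s - y = l\<close> is a subgradient of \<open>g\<close> at \<open>y\<close>,
  each \<open>y (Suc k)\<close> is the proximal point of \<open>s (Suc k)\<close>; proximal maps are
  nonexpansive because subdifferentials are monotone.\<close>

lemma y_nonexpansive: "norm (y (Suc j) - y (Suc k)) \<le> norm (s (Suc j) - s (Suc k))"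
proof -
  define p where "p = y (Suc j) - y (Suc k)"
  define m where "m = l (Suc j) - l (Suc k)"
  have "0 \<le> m \<bullet> p"
    using y_variational[of k "y (Suc j)"] y_variational[of j "y (Suc k)"]
    by (simp add: p_def m_def inner_diff_left inner_diff_right algebra_simps)
  then have "(norm p)\<^sup>2 \<le> (norm (p + m))\<^sup>2"
    unfolding power2_norm_eq_inner by (simp add: inner_add_left inner_add_right inner_commute)
  moreover have "s (Suc j) - s (Suc k) = p + m" by (simp add: s_def p_def m_def)
  ultimately show ?thesis by (simp add: p_def abs_le_square_iff[symmetric])
qed

section \<open>Consequences of a saddle point: boundedness, vanishing residuals, limit of the
  objective\<close>

context
  fixes xs ls
  assumes saddle: "saddle xs ls"
begin

lemma s_dist_mono:
  "m \<le> n \<Longrightarrow> norm (s (Suc n) - (M xs + c + ls)) \<le> norm (s (Suc m) - (M xs + c + ls))"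
proof (induction n rule: dec_induct)
  case (step n)
  have "(norm (s (Suc (Suc n)) - (M xs + c + ls)))\<^sup>2 \<le> (norm (s (Suc n) - (M xs + c + ls)))\<^sup>2"
    using s_Fejer[OF saddle, of n] zero_le_power2[of "norm (s (Suc (Suc n)) - s (Suc n))"] by linarith
  then show ?case using step.IH by (simp add: abs_le_square_iff[symmetric])
qed simp

lemma s_diff_tendsto: "(\<lambda>k. s (Suc (Suc k)) - s (Suc k)) \<longlonglongrightarrow> 0"
proof -
  define D where "D k = (norm (s (Suc k) - (M xs + c + ls)))\<^sup>2" for k
  \<comment> \<open>The squared increments are bounded by the decrements of a convergent monotone
    sequence.\<close>
  have step: "(norm (s (Suc (Suc k)) - s (Suc k)))\<^sup>2 \<le> D k - D (Suc k)" for k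
    using s_Fejer[OF saddle, of k] by (simp add: D_def)
  have "decseq D"
    by (rule decseq_SucI) (use step zero_le_power2 in \<open>smt (verit, best)\<close>)
  moreover have "bdd_below (range D)" by (rule bdd_belowI[of _ 0]) (auto simp: D_def)
  ultimately have lim: "D \<longlonglongrightarrow> (INF k. D k)" by (rule LIMSEQ_decseq_INF[rotated])
  then have "(\<lambda>k. D k - D (Suc k)) \<longlonglongrightarrow> 0"
    using tendsto_diff[OF lim LIMSEQ_Suc[OF lim]] by simp
  then have "(\<lambda>k. (norm (s (Suc (Suc k)) - s (Suc k)))\<^sup>2) \<longlonglongrightarrow> 0"
    by (rule tendsto_sandwich[OF _ _ tendsto_const, rotated 2]) (auto simp: step)
  then have "(\<lambda>k. norm (s (Suc (Suc k)) - s (Suc k))) \<longlonglongrightarrow> 0" by simp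
  then show ?thesis by (rule tendsto_norm_zero_cancel)
qed

lemma y_diff_tendsto: "(\<lambda>k. y (Suc (Suc k)) - y (Suc k)) \<longlonglongrightarrow> 0"
  by (rule Lim_null_comparison[OF _ tendsto_norm_zero[OF s_diff_tendsto]])
    (simp add: y_nonexpansive)

text \<open>The residual is the increment of \<open>l\<close>, that is, the increment of
  \<open>s\<close> minus that of \<open>y\<close>.\<close>

lemma residual_tendsto: "(\<lambda>k. M (x k) + c - y k) \<longlonglongrightarrow> 0"
proof -
  have "M (x (Suc (Suc k))) + c - y (Suc (Suc k))
      = (s (Suc (Suc k)) - s (Suc k)) - (y (Suc (Suc k)) - y (Suc k))" for k
    by (simp add: s_def l_step[of "Suc k"])
  then have "(\<lambda>k. M (x (Suc (Suc k))) + c - y (Suc (Suc k))) \<longlonglongrightarrow> 0"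
    using tendsto_diff[OF s_diff_tendsto y_diff_tendsto] by (simp only: diff_zero)
  then show ?thesis
    by (subst (asm) filterlim_sequentially_Suc[of "\<lambda>k. M (x (Suc k)) + c - y (Suc k)"])
      (subst (asm) filterlim_sequentially_Suc)
qed

lemma s_bounded: "\<exists>B. \<forall>k. norm (s k) \<le> B"
proof -
  have "norm (s (Suc k)) \<le> norm (s (Suc 0) - (M xs + c + ls)) + norm (M xs + c + ls)" for k
    using s_dist_mono[of 0 k] norm_triangle_sub[of "s (Suc k)" "M xs + c + ls"] by simp
  then have "norm (s k) \<le> max (norm (s 0)) (norm (s (Suc 0) - (M xs + c + ls)) + norm (M xs + c + ls))" for k
    by (cases k) (auto simp: le_max_iff_disj)
  then show ?thesis by blast
qed

lemma y_bounded: "\<exists>B. \<forall>k. norm (y k) \<le> B"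
proof -
  obtain B where B: "\<And>k. norm (s k) \<le> B" using s_bounded by blast
  have "norm (y (Suc k)) \<le> norm (y (Suc 0)) + 2 * B" for k
    using y_nonexpansive[of k 0] norm_triangle_ineq4[of "s (Suc k)" "s (Suc 0)"]
      norm_triangle_sub[of "y (Suc k)" "y (Suc 0)"] B[of "Suc k"] B[of "Suc 0"] by linarith
  then have "norm (y k) \<le> max (norm (y 0)) (norm (y (Suc 0)) + 2 * B)" for k
    by (cases k) (auto simp: le_max_iff_disj)
  then show ?thesis by blast
qed

lemma l_bounded: "\<exists>B. \<forall>k. norm (l k) \<le> B"
proof -
  obtain B where B: "\<And>k. norm (s k) \<le> B" using s_bounded by blast
  obtain B' where B': "\<And>k. norm (y k) \<le> B'" using y_bounded by blast
  have "norm (l k) \<le> B + B'" for k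
    using norm_triangle_ineq4[of "s k" "y k"] B[of k] B'[of k] by (simp add: s_def)
  then show ?thesis by blast
qed

text \<open>The iterates are infeasible, so the objective may lie below its optimum and needs bounds
  on both sides. The saddle inequalities give the lower one and the variational inequalities tested
  at the saddle point the upper one. All error terms pair a bounded sequence with a vanishing one,
  so convergence of the iterates is not involved.\<close>

lemma objective_tendsto: "(\<lambda>k. f (x k) + g (y k)) \<longlonglongrightarrow> f xs + g (M xs + c)"
proof -
  define ys where "ys = M xs + c"
  define r where "r k = M (x k) + c - y k" for k
  have r0: "r \<longlonglongrightarrow> 0" unfolding r_def by (rule residual_tendsto)
  let ?k = "\<lambda>k. Suc (Suc k)"
  have lower: "f xs + g ys - ls \<bullet> r (?k k) \<le> f (x (?k k)) + g (y (?k k))" for k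
  proof -
    have "f xs + ls \<bullet> M xs \<le> f (x (?k k)) + ls \<bullet> M (x (?k k))"
      using saddle x_mem[of "Suc k"] by (simp add: saddle_def)
    moreover have "g ys + ls \<bullet> (y (?k k) - ys) \<le> g (y (?k k))"
      using saddle by (simp add: saddle_def ys_def)
    ultimately show ?thesis
      by (simp add: r_def ys_def inner_diff_right inner_add_right algebra_simps)
  qed
  have upper: "f (x (?k k)) + g (y (?k k)) \<le>
      f xs + g ys + (y (?k k) - y (Suc k)) \<bullet> (ys - y (?k k) - r (?k k)) - l (?k k) \<bullet> r (?k k)" for k
  proof -
    have xs: "xs \<in> S" using saddle by (simp add: saddle_def)
    have "0 \<le> f xs - f (x (?k k)) + (l (?k k) + (y (?k k) - y (Suc k))) \<bullet> (ys - y (?k k) - r (?k k))"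
      using x_variational[OF xs, of "Suc k"]
      by (simp add: l_step[of "Suc k"] r_def ys_def algebra_simps)
    moreover have "g (y (?k k)) + l (?k k) \<bullet> (ys - y (?k k)) \<le> g ys" by (rule y_variational)
    ultimately show ?thesis by (simp add: inner_add_left inner_diff_right algebra_simps)
  qed
  have lim1: "(\<lambda>k. f xs + g ys - ls \<bullet> r (?k k)) \<longlonglongrightarrow> f xs + g ys - ls \<bullet> 0"
    using LIMSEQ_Suc[OF LIMSEQ_Suc[OF r0]] by (intro tendsto_intros)
  have r2: "(\<lambda>k. r (?k k)) \<longlonglongrightarrow> 0" by (rule LIMSEQ_Suc[OF LIMSEQ_Suc[OF r0]])
  have lr: "(\<lambda>k. l (?k k) \<bullet> r (?k k)) \<longlonglongrightarrow> 0"
  proof -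
    obtain B where B: "\<And>k. norm (l k) \<le> B" using l_bounded by blast
    have "norm (l (?k k) \<bullet> r (?k k)) \<le> B * norm (r (?k k))" for k
      using Cauchy_Schwarz_ineq2[of "l (?k k)" "r (?k k)"] mult_right_mono[OF B[of "?k k"], of "norm (r (?k k))"]
      by simp
    then show ?thesis
      by (intro Lim_null_comparison[OF _ tendsto_mult_right_zero[OF tendsto_norm_zero[OF r2]], of _ B]) auto
  qed
  have yr: "(\<lambda>k. (y (?k k) - y (Suc k)) \<bullet> (ys - y (?k k) - r (?k k))) \<longlonglongrightarrow> 0"
  proof -
    obtain B where B: "\<And>k. norm (y k) \<le> B" using y_bounded by blast
    define d where "d k = y (?k k) - y (Suc k)" for k
    have d0: "d \<longlonglongrightarrow> 0" unfolding d_def by (rule y_diff_tendsto)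
    have "norm (d k \<bullet> (ys - y (?k k))) \<le> norm (d k) * (norm ys + B)" for k
    proof -
      have "norm (ys - y (?k k)) \<le> norm ys + B"
        using norm_triangle_ineq4[of ys "y (?k k)"] B[of "?k k"] by linarith
      then show ?thesis
        using Cauchy_Schwarz_ineq2[of "d k" "ys - y (?k k)"] mult_left_mono[of _ _ "norm (d k)"]
        by (smt (verit, best) norm_ge_zero real_norm_def)
    qed
    then have "(\<lambda>k. d k \<bullet> (ys - y (?k k))) \<longlonglongrightarrow> 0"
      by (intro Lim_null_comparison[OF _ tendsto_mult_left_zero[OF tendsto_norm_zero[OF d0]], of _ "norm ys + B"]) auto
    from tendsto_diff[OF this tendsto_inner[OF d0 r2]] show ?thesis
      by (simp add: d_def inner_diff_right algebra_simps)
  qed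
  have lim2: "(\<lambda>k. f xs + g ys + (y (?k k) - y (Suc k)) \<bullet> (ys - y (?k k) - r (?k k)) - l (?k k) \<bullet> r (?k k))
      \<longlonglongrightarrow> f xs + g ys + 0 - 0"
    by (intro tendsto_intros yr lr)
  have "(\<lambda>k. f (x (?k k)) + g (y (?k k))) \<longlonglongrightarrow> f xs + g ys"
    by (rule tendsto_sandwich[OF always_eventually[OF allI[OF lower]] always_eventually[OF allI[OF upper]]])
      (use lim1 lim2 in simp_all)
  then show ?thesis
    unfolding ys_def
    by (subst (asm) filterlim_sequentially_Suc[of "\<lambda>k. f (x (Suc k)) + g (y (Suc k))"])
      (subst (asm) filterlim_sequentially_Suc)
qed

end

end

section \<open>Linear convergence from error bounds\<close>

text \<open>R-linear convergence: the error lies below a geometric sequence but need not shrink at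
  every step. This form passes through linear maps, pairs and index shifts.\<close>

definition linearly_convergent :: "(nat \<Rightarrow> 'a::real_normed_vector) \<Rightarrow> bool" where
  "linearly_convergent z \<longleftrightarrow> (\<exists>zs C r. 0 \<le> r \<and> r < 1 \<and> (\<forall>k. norm (z k - zs) \<le> C * r ^ k))"

lemma linearly_convergentI:
  assumes "0 \<le> r" "r < 1" "\<And>k. norm (z k - zs) \<le> C * r ^ k"
  shows "linearly_convergent z"
  using assms unfolding linearly_convergent_def by blast

lemma linearly_convergent_const: "linearly_convergent (\<lambda>k. c)"
  by (rule linearly_convergentI[of 0 _ c 0]) auto

lemma linearly_convergent_bounded_linear:
  assumes "bounded_linear T" "linearly_convergent z"
  shows "linearly_convergent (\<lambda>k. T (z k))"
proof -
  obtain zs C r where r: "0 \<le> r" "r < 1" and z: "\<And>k. norm (z k - zs) \<le> C * r ^ k"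
    using assms(2) unfolding linearly_convergent_def by blast
  obtain K where K: "K \<ge> 0" "\<And>v. norm (T v) \<le> norm v * K"
    using bounded_linear.nonneg_bounded[OF assms(1)] by blast
  have "norm (T (z k) - T zs) \<le> (C * K) * r ^ k" for k
  proof -
    have "norm (T (z k) - T zs) \<le> norm (z k - zs) * K"
      using K(2)[of "z k - zs"] by (simp add: linear_diff[OF bounded_linear.linear[OF assms(1)]])
    also have "\<dots> \<le> (C * r ^ k) * K" using z K by (intro mult_right_mono)
    finally show ?thesis by (simp add: algebra_simps)
  qed
  then show ?thesis using r by (intro linearly_convergentI)
qed

lemma linearly_convergent_Pair:
  assumes "linearly_convergent u" "linearly_convergent v"
  shows "linearly_convergent (\<lambda>k. (u k, v k))"
proof -
  obtain us C r where r: "0 \<le> r" "r < 1" and u: "\<And>k. norm (u k - us) \<le> C * r ^ k"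
    using assms(1) unfolding linearly_convergent_def by blast
  obtain vs D p where p: "0 \<le> p" "p < 1" and v: "\<And>k. norm (v k - vs) \<le> D * p ^ k"
    using assms(2) unfolding linearly_convergent_def by blast
  have C: "C \<ge> 0" using order_trans[OF norm_ge_zero u[of 0]] by simp
  have D: "D \<ge> 0" using order_trans[OF norm_ge_zero v[of 0]] by simp
  have "norm ((u k, v k) - (us, vs)) \<le> (C + D) * (max r p) ^ k" for k
  proof -
    have "norm ((u k, v k) - (us, vs)) \<le> norm (u k - us) + norm (v k - vs)"
      by (simp add: norm_Pair sqrt_sum_squares_le_sum)
    also have "\<dots> \<le> C * r ^ k + D * p ^ k" using u v by (intro add_mono)
    also have "\<dots> \<le> C * (max r p) ^ k + D * (max r p) ^ k"
      using C D r p by (intro add_mono mult_left_mono power_mono) auto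
    finally show ?thesis by (simp add: algebra_simps)
  qed
  then show ?thesis using r p by (intro linearly_convergentI[of "max r p" _ "(us, vs)" "C + D"]) auto
qed

lemma linearly_convergent_diff:
  assumes "linearly_convergent u" "linearly_convergent v"
  shows "linearly_convergent (\<lambda>k. u k - v k)"
  using linearly_convergent_bounded_linear[OF bounded_linear_sub[OF bounded_linear_fst bounded_linear_snd]
      linearly_convergent_Pair[OF assms]] by simp

lemma linearly_convergent_of_Suc:
  assumes "linearly_convergent (\<lambda>k. z (Suc k))"
  shows "linearly_convergent z"
proof -
  obtain zs C r where r: "0 \<le> r" "r < 1" and z: "\<And>k. norm (z (Suc k) - zs) \<le> C * r ^ k"
    using assms unfolding linearly_convergent_def by blast
  \<comment> \<open>Division by the rate absorbs the index shift, so the rate is first made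
    positive.\<close>
  define p where "p = max r (1/2)"
  have p: "0 < p" "p < 1" "r \<le> p" using r by (auto simp: p_def)
  have C: "C \<ge> 0" using order_trans[OF norm_ge_zero z[of 0]] by simp
  have "norm (z k - zs) \<le> (norm (z 0 - zs) + C / p) * p ^ k" for k
  proof (cases k)
    case 0
    then show ?thesis using C p by simp
  next
    case (Suc j)
    have "norm (z k - zs) \<le> C * r ^ j" using z Suc by simp
    also have "\<dots> \<le> C * p ^ j" using C r p by (intro mult_left_mono power_mono) auto
    also have "\<dots> = (C / p) * p ^ k" using p Suc by simp
    also have "\<dots> \<le> (norm (z 0 - zs) + C / p) * p ^ k" using p by (intro mult_right_mono) auto
    finally show ?thesis .
  qed
  then show ?thesis using p by (intro linearly_convergentI[of p]) auto
qed

text \<open>Taking the infimum over \<open>Z\<close> in the Fejer inequality bounds the new squared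
  distance plus the squared increment by the old squared distance. By the error bound the increment
  is at least \<open>d k / \<theta>\<close>, so the distance contracts by \<open>\<rho>\<close>.
  Fejer monotonicity then turns decay of the distance into a Cauchy estimate.\<close>

lemma Fejer_error_bound_linearly_convergent:
  fixes s :: "nat \<Rightarrow> 'a::banach"
  assumes fejer: "\<And>k z. z \<in> Z \<Longrightarrow>
      (norm (s (Suc k) - z))\<^sup>2 + (norm (s (Suc k) - s k))\<^sup>2 \<le> (norm (s k - z))\<^sup>2"
    and err: "\<And>k. \<exists>z\<in>Z. norm (s k - z) \<le> \<kappa> * norm (s (Suc k) - s k)"
  shows "linearly_convergent s"
proof -
  \<comment> \<open>Raising \<open>\<kappa>\<close> to at least 1 ensures that
    \<open>1 - 1 / \<theta>\<^sup>2\<close> is nonnegative and below 1.\<close>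
  define \<theta> where "\<theta> = max \<kappa> 1"
  define d where "d k = infdist (s k) Z" for k
  define \<rho> where "\<rho> = sqrt (1 - 1 / \<theta>\<^sup>2)"
  have Z: "Z \<noteq> {}" using err by blast
  have d_le: "d k \<le> norm (s k - z)" if "z \<in> Z" for k z
    using infdist_le[OF that, of "s k"] by (simp add: d_def dist_norm)
  have d0: "d k \<ge> 0" for k by (simp add: d_def infdist_nonneg)
  have le_d: "e \<le> d k" if "\<And>z. z \<in> Z \<Longrightarrow> e \<le> norm (s k - z)" for e k
    unfolding d_def infdist_notempty[OF Z] by (rule cINF_greatest[OF Z]) (simp add: that dist_norm)
  have \<theta>: "\<theta> \<ge> 1" by (simp add: \<theta>_def)
  then have "1 / \<theta>\<^sup>2 \<le> 1" "1 / \<theta>\<^sup>2 > 0" using one_le_power[OF \<theta>, of 2] by auto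
  then have \<rho>: "0 \<le> \<rho>" "\<rho> < 1" "\<rho>\<^sup>2 = 1 - 1 / \<theta>\<^sup>2" by (auto simp: \<rho>_def)
  have step: "d (Suc k) \<le> \<rho> * d k" for k
  proof -
    obtain w where "w \<in> Z" "norm (s k - w) \<le> \<kappa> * norm (s (Suc k) - s k)" using err by blast
    then have "d k \<le> \<kappa> * norm (s (Suc k) - s k)" using d_le[of w k] by linarith
    also have "\<dots> \<le> \<theta> * norm (s (Suc k) - s k)" by (intro mult_right_mono) (auto simp: \<theta>_def)
    finally have "d k / \<theta> \<le> norm (s (Suc k) - s k)" using \<theta> by (simp add: field_simps)
    then have inc: "(d k / \<theta>)\<^sup>2 \<le> (norm (s (Suc k) - s k))\<^sup>2"
      using d0 \<theta> by (intro power_mono) auto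
    \<comment> \<open>No nearest point is chosen: the bound is shown against every \<open>z\<close>
      in \<open>Z\<close> and passed to the infimum by \<open>le_d\<close>.\<close>
    have "sqrt ((d (Suc k))\<^sup>2 + (d k / \<theta>)\<^sup>2) \<le> norm (s k - z)" if z: "z \<in> Z" for z
    proof (rule real_le_lsqrt)
      have "(d (Suc k))\<^sup>2 \<le> (norm (s (Suc k) - z))\<^sup>2" using d_le[OF z] d0 by (intro power_mono) auto
      then show "(d (Suc k))\<^sup>2 + (d k / \<theta>)\<^sup>2 \<le> (norm (s k - z))\<^sup>2"
        using fejer[OF z, of k] inc by linarith
    qed auto
    then have "sqrt ((d (Suc k))\<^sup>2 + (d k / \<theta>)\<^sup>2) \<le> d k" by (rule le_d)
    then have "(d (Suc k))\<^sup>2 + (d k / \<theta>)\<^sup>2 \<le> (d k)\<^sup>2" by (rule sqrt_le_D)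
    moreover have "(\<rho> * d k)\<^sup>2 = (d k)\<^sup>2 - (d k / \<theta>)\<^sup>2"
      unfolding power_mult_distrib \<rho>(3) power_divide by (simp add: left_diff_distrib)
    ultimately have "(d (Suc k))\<^sup>2 \<le> (\<rho> * d k)\<^sup>2" by linarith
    then show ?thesis by (rule power2_le_imp_le) (simp add: d0 \<rho>(1))
  qed
  have dk: "d k \<le> d 0 * \<rho> ^ k" for k
  proof (induction k)
    case (Suc k)
    have "d (Suc k) \<le> \<rho> * (d 0 * \<rho> ^ k)" using step[of k] mult_left_mono[OF Suc \<rho>(1)] by linarith
    then show ?case by (simp add: algebra_simps)
  qed simp
  have mono: "norm (s m - z) \<le> norm (s k - z)" if "z \<in> Z" "k \<le> m" for z k m
    using that(2)
  proof (induction m rule: dec_induct)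
    case (step n)
    have "(norm (s (Suc n) - z))\<^sup>2 \<le> (norm (s n - z))\<^sup>2"
      using fejer[OF that(1), of n] zero_le_power2[of "norm (s (Suc n) - s n)"] by linarith
    then show ?case using step.IH by (simp add: abs_le_square_iff[symmetric])
  qed simp
  \<comment> \<open>For every \<open>z\<close> in \<open>Z\<close> both \<open>s k\<close> and
    \<open>s m\<close> lie within \<open>norm (s k - z)\<close> of \<open>z\<close>; the infimum
    over \<open>z\<close> gives the factor 2.\<close>
  have close: "norm (s m - s k) \<le> 2 * d k" if km: "k \<le> m" for k m
  proof -
    have "norm (s m - s k) / 2 \<le> norm (s k - z)" if "z \<in> Z" for z
      using mono[OF that km] norm_triangle_ineq4[of "s m - z" "s k - z"] by simp
    then have "norm (s m - s k) / 2 \<le> d k" by (rule le_d)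
    then show ?thesis by simp
  qed
  have lim0: "(\<lambda>k. 2 * (d 0 * \<rho> ^ k)) \<longlonglongrightarrow> 0"
    using \<rho> by (intro tendsto_mult_right_zero LIMSEQ_realpow_zero)
  have "Cauchy s"
  proof (rule CauchyI')
    fix e :: real assume "0 < e"
    from order_tendstoD(2)[OF lim0 this] obtain N where N: "\<And>k. k \<ge> N \<Longrightarrow> 2 * (d 0 * \<rho> ^ k) < e"
      by (auto simp: eventually_sequentially)
    have "norm (s m - s n) < e" if "m \<ge> N" "n > m" for m n
      using close[of m n] dk[of m] N[OF that(1)] that by (simp add: norm_minus_commute)
    then show "\<exists>N. \<forall>m\<ge>N. \<forall>n>m. dist (s m) (s n) < e" by (auto simp: dist_norm)
  qed
  then obtain S where S: "s \<longlonglongrightarrow> S" using Cauchy_convergent_iff convergent_def by blast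
  have "norm (s k - S) \<le> (2 * d 0) * \<rho> ^ k" for k
  proof -
    have "(\<lambda>m. norm (s m - s k)) \<longlonglongrightarrow> norm (S - s k)" by (intro tendsto_intros S)
    then have "norm (S - s k) \<le> 2 * d k"
      by (rule LIMSEQ_le_const2) (use close in blast)
    then show ?thesis using dk[of k] by (simp add: norm_minus_commute)
  qed
  then show ?thesis using \<rho> by (intro linearly_convergentI)
qed

section \<open>Error bounds for linear equations on finite unions of boxes\<close>

text \<open>If the box contains a solution \<open>z0\<close>, the coordinatewise correction of
  \<open>z - z0\<close> leads from \<open>z\<close> to a solution without leaving the box. If it
  contains none, compactness keeps the residual away from zero, and on a bounded set any fixed point
  of \<open>Z\<close> is close enough after scaling.\<close>

lemma interval_error_bound:
  fixes G :: "'a::euclidean_space \<Rightarrow> 'b::real_normed_vector"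
  assumes G: "linear G" and B: "closed B" "is_interval B" and T: "bounded T"
    and Z: "{z\<in>B. G z = a} \<subseteq> Z" "Z \<noteq> {}"
  shows "\<exists>\<kappa>\<ge>0. \<forall>z\<in>B \<inter> T. \<exists>z'\<in>Z. norm (z - z') \<le> \<kappa> * norm (G z - a)"
proof (cases "{z\<in>B. G z = a} = {}")
  case False
  then obtain z0 where z0: "z0 \<in> B" "G z0 = a" by blast
  obtain K where K: "K \<ge> 0"
    "\<And>d. \<exists>v. (\<forall>b\<in>Basis. min 0 (d \<bullet> b) \<le> v \<bullet> b \<and> v \<bullet> b \<le> max 0 (d \<bullet> b)) \<and> G v = G d \<and>
            norm v \<le> K * norm (G d)"
    using coordinatewise_Hoffman[OF G] by blast
  have "\<exists>z'\<in>Z. norm (z - z') \<le> K * norm (G z - a)" if z: "z \<in> B" for z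
  proof -
    obtain v where v: "\<And>b. b \<in> Basis \<Longrightarrow> min 0 ((z - z0) \<bullet> b) \<le> v \<bullet> b \<and> v \<bullet> b \<le> max 0 ((z - z0) \<bullet> b)"
      "G v = G (z - z0)" "norm v \<le> K * norm (G (z - z0))"
      using K(2) by metis
    have "z - v \<in> B"
    proof -
      have "z \<bullet> b \<le> (z - v) \<bullet> b \<and> (z - v) \<bullet> b \<le> z0 \<bullet> b \<or> z0 \<bullet> b \<le> (z - v) \<bullet> b \<and> (z - v) \<bullet> b \<le> z \<bullet> b"
        if "b \<in> Basis" for b
        using v(1)[OF that] by (auto simp: inner_diff_left min_def max_def split: if_splits)
      then show ?thesis using B(2) z z0(1) unfolding is_interval_def by blast
    qed
    moreover have "G (z - v) = a" by (simp add: linear_diff[OF G] v(2) z0(2))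
    ultimately have "z - v \<in> Z" using Z(1) by blast
    moreover have "norm (z - (z - v)) \<le> K * norm (G z - a)"
      using v(3) by (simp add: linear_diff[OF G] z0(2))
    ultimately show ?thesis by blast
  qed
  then show ?thesis using K(1) by blast
next
  case True
  obtain z0 where z0: "z0 \<in> Z" using Z(2) by blast
  obtain R where R: "\<And>z. z \<in> T \<Longrightarrow> norm z \<le> R" using T by (auto simp: bounded_iff)
  show ?thesis
  proof (cases "B \<inter> closure T = {}")
    case True
    then have "B \<inter> T = {}" using closure_subset by blast
    then show ?thesis by (intro exI[of _ 0]) auto
  next
    case ne: False
    have "compact (B \<inter> closure T)" using B T by (simp add: closed_Int_compact compact_closure)
    moreover have "continuous_on (B \<inter> closure T) (\<lambda>z. norm (G z - a))"
      by (intro continuous_intros linear_continuous_on) (use G in \<open>simp add: linear_conv_bounded_linear\<close>)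
    ultimately obtain w where w: "w \<in> B \<inter> closure T"
      and min: "\<forall>z\<in>B \<inter> closure T. norm (G w - a) \<le> norm (G z - a)"
      using ne continuous_attains_inf by blast
    define e where "e = norm (G w - a)"
    have e: "e > 0" using w True by (auto simp: e_def)
    \<comment> \<open>The numerator bounds the distance from \<open>z0\<close> to any point of
      \<open>T\<close>, and \<open>e\<close> is the least residual on the compact set.\<close>
    define \<kappa> where "\<kappa> = (\<bar>R\<bar> + norm z0) / e"
    have "norm (z - z0) \<le> \<kappa> * norm (G z - a)" if z: "z \<in> B" "z \<in> T" for z
    proof -
      have "norm (z - z0) \<le> \<kappa> * e"
        using R[OF z(2)] norm_triangle_ineq4[of z z0] e by (simp add: \<kappa>_def)
      also have "\<dots> \<le> \<kappa> * norm (G z - a)"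
        using min z closure_subset[of T] e by (intro mult_left_mono) (auto simp: e_def \<kappa>_def)
      finally show ?thesis .
    qed
    moreover have "\<kappa> \<ge> 0" using e by (simp add: \<kappa>_def)
    ultimately show ?thesis using z0 by blast
  qed
qed

text \<open>Only the union has to contain a solution: points of a box without one are compared with
  solutions in other boxes.\<close>

lemma finite_intervals_error_bound:
  fixes G :: "'a::euclidean_space \<Rightarrow> 'b::real_normed_vector"
  assumes G: "linear G" and fin: "finite \<B>" and B: "\<And>B. B \<in> \<B> \<Longrightarrow> closed B \<and> is_interval B"
    and T: "bounded T" and ne: "{z\<in>\<Union>\<B>. G z = a} \<noteq> {}"
  obtains \<kappa> where "\<kappa> \<ge> 0"
    "\<And>z. z \<in> \<Union>\<B> \<Longrightarrow> z \<in> T \<Longrightarrow> \<exists>z'\<in>\<Union>\<B>. G z' = a \<and> norm (z - z') \<le> \<kappa> * norm (G z - a)"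
proof -
  define Z where "Z = {z\<in>\<Union>\<B>. G z = a}"
  have "\<exists>\<kappa>\<ge>0. \<forall>z\<in>B \<inter> T. \<exists>z'\<in>Z. norm (z - z') \<le> \<kappa> * norm (G z - a)" if "B \<in> \<B>" for B
    by (rule interval_error_bound[OF G _ _ T]) (use B[OF that] that ne in \<open>auto simp: Z_def\<close>)
  then obtain k where k: "\<And>B. B \<in> \<B> \<Longrightarrow> k B \<ge> 0 \<and> (\<forall>z\<in>B \<inter> T. \<exists>z'\<in>Z. norm (z - z') \<le> k B * norm (G z - a))"
    by metis
  show thesis
  proof (rule that)
    show "sum k \<B> \<ge> 0" using k by (simp add: sum_nonneg)
    fix z assume "z \<in> \<Union>\<B>" "z \<in> T"
    then obtain B z' where B': "B \<in> \<B>" and z': "z' \<in> Z" "norm (z - z') \<le> k B * norm (G z - a)"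
      using k by blast
    have "k B \<le> sum k \<B>" using fin B' k by (intro member_le_sum) auto
    then have "norm (z - z') \<le> sum k \<B> * norm (G z - a)"
      using z'(2) mult_right_mono[of "k B" "sum k \<B>" "norm (G z - a)"] by simp
    then show "\<exists>z'\<in>\<Union>\<B>. G z' = a \<and> norm (z - z') \<le> sum k \<B> * norm (G z - a)"
      using z'(1) unfolding Z_def by blast
  qed
qed

text \<open>Turns orthogonality to a subspace into a linear equation, so that it can join a linear
  system. The map is of Gram type rather than a projection, so any finite spanning set will
  do.\<close>

lemma orthogonality_kernel:
  fixes S :: "'a::euclidean_space set"
  assumes "subspace S"
  obtains q :: "'a \<Rightarrow> 'a" where "linear q" "\<And>w. q w = 0 \<longleftrightarrow> (\<forall>d\<in>S. w \<bullet> d = 0)"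
proof -
  obtain B where B: "finite B" "span B = S"
    using basis_exists[of S] assms by (metis basis_subspace_exists)
  define q where "q w = (\<Sum>b\<in>B. (w \<bullet> b) *\<^sub>R b)" for w
  show thesis
  proof (rule that)
    show "linear q"
      by (rule linearI) (auto simp: q_def inner_add_left scaleR_add_left sum.distrib scaleR_sum_right)
    fix w
    show "q w = 0 \<longleftrightarrow> (\<forall>d\<in>S. w \<bullet> d = 0)"
    proof
      assume "q w = 0"
      \<comment> \<open>The sum of squares is the inner product of \<open>q w\<close> with
        \<open>w\<close>.\<close>
      then have "(\<Sum>b\<in>B. (w \<bullet> b)\<^sup>2) = 0"
        using inner_sum_left[of "\<lambda>b. (w \<bullet> b) *\<^sub>R b" B w]
        by (simp add: q_def power2_eq_square inner_commute)
      then have *: "\<forall>b\<in>B. w \<bullet> b = 0" using B(1) by (simp add: sum_nonneg_eq_0_iff)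
      show "\<forall>d\<in>S. w \<bullet> d = 0"
      proof
        fix d assume "d \<in> S"
        then have "d \<in> span B" using B(2) by simp
        then show "w \<bullet> d = 0"
          by (induction rule: span_induct_alt) (use * in \<open>auto simp: inner_add_right\<close>)
      qed
    next
      assume "\<forall>d\<in>S. w \<bullet> d = 0"
      then have "\<forall>b\<in>B. w \<bullet> b = 0" using B(2) span_superset[of B] by blast
      then show "q w = 0" by (simp add: q_def)
    qed
  qed
qed

section \<open>Linear rate for quadratic plus polyhedral objectives\<close>

text \<open>\<open>g\<close> is the support function of the box between \<open>lo\<close> and
  \<open>hi\<close>, so its subgradients are found coordinate by coordinate. \<open>inj_M\<close>
  allows \<open>x\<close> to be recovered from \<open>M x\<close>, which transfers bounds and rates
  to \<open>x\<close>.\<close>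

locale admm_quadratic_polyhedral = admm M c S f g x y l
  for M :: "'a::euclidean_space \<Rightarrow> 'b::euclidean_space" and c S f g x y l +
  fixes Q :: "'a \<Rightarrow> 'a" and lo hi :: 'b
  assumes inj_M: "inj M" and subspace_S: "subspace S"
    and linear_Q: "linear Q" and Q_sym: "\<And>u v. Q u \<bullet> v = u \<bullet> Q v" and Q_psd: "\<And>u. 0 \<le> Q u \<bullet> u"
    and f_eq: "\<And>z. f z = (1/2) * (Q z \<bullet> z)"
    and lo_le_hi: "\<And>b. b \<in> Basis \<Longrightarrow> lo \<bullet> b \<le> hi \<bullet> b"
    and g_eq: "\<And>w. g w = (\<Sum>b\<in>Basis. max ((lo \<bullet> b) * (w \<bullet> b)) ((hi \<bullet> b) * (w \<bullet> b)))"
begin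

definition complementary :: "'b \<Rightarrow> 'b \<Rightarrow> bool" where
  "complementary w m \<longleftrightarrow> (\<forall>b\<in>Basis. lo \<bullet> b \<le> m \<bullet> b \<and> m \<bullet> b \<le> hi \<bullet> b \<and>
     (w \<bullet> b > 0 \<longrightarrow> m \<bullet> b = hi \<bullet> b) \<and> (w \<bullet> b < 0 \<longrightarrow> m \<bullet> b = lo \<bullet> b))"

text \<open>Varying one coordinate reduces the forward direction to a positively homogeneous
  function of one real variable. Conversely, any \<open>m\<close> in the box satisfies
  \<open>m \<bullet> v \<le> g v\<close>, and complementarity makes this an equality at
  \<open>w\<close>.\<close>

lemma g_subgradient_iff: "(\<forall>v. g w + m \<bullet> (v - w) \<le> g v) \<longleftrightarrow> complementary w m"
proof
  assume sub: "\<forall>v. g w + m \<bullet> (v - w) \<le> g v"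
  show "complementary w m"
    unfolding complementary_def
  proof
    fix b :: 'b assume b: "b \<in> Basis"
    define h where "h t = max ((lo \<bullet> b) * t) ((hi \<bullet> b) * t)" for t
    have h: "h (w \<bullet> b) + (m \<bullet> b) * t \<le> h (w \<bullet> b + t)" for t
    proof -
      have *: "g v = h (v \<bullet> b) + (\<Sum>i\<in>Basis - {b}. max ((lo \<bullet> i) * (v \<bullet> i)) ((hi \<bullet> i) * (v \<bullet> i)))" for v
        unfolding g_eq h_def using b by (simp add: sum.remove[OF finite_Basis b])
      have "g (w + t *\<^sub>R b) = h (w \<bullet> b + t) +
          (\<Sum>i\<in>Basis - {b}. max ((lo \<bullet> i) * (w \<bullet> i)) ((hi \<bullet> i) * (w \<bullet> i)))"
        unfolding * using b by (auto simp: inner_add_left inner_Basis intro!: sum.cong split: if_splits)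
      then show ?thesis using sub[rule_format, of "w + t *\<^sub>R b"] unfolding *[of w]
        by (simp add: mult.commute)
    qed
    have hpos: "h t = (hi \<bullet> b) * t" if "t \<ge> 0" for t
      unfolding h_def using lo_le_hi[OF b] that by (simp add: max_absorb2 mult_right_mono)
    have hneg: "h t = (lo \<bullet> b) * t" if "t \<le> 0" for t
      unfolding h_def using lo_le_hi[OF b] that by (simp add: max_absorb1 mult_right_mono_neg)
    consider "w \<bullet> b > 0" | "w \<bullet> b < 0" | "w \<bullet> b = 0" by linarith
    then show "lo \<bullet> b \<le> m \<bullet> b \<and> m \<bullet> b \<le> hi \<bullet> b \<and>
        (w \<bullet> b > 0 \<longrightarrow> m \<bullet> b = hi \<bullet> b) \<and> (w \<bullet> b < 0 \<longrightarrow> m \<bullet> b = lo \<bullet> b)"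
    proof cases
      case 1
      \<comment> \<open>The coordinate is tested once doubled and once set to zero.\<close>
      have "(m \<bullet> b) * (w \<bullet> b) \<le> (hi \<bullet> b) * (w \<bullet> b)"
        using h[of "w \<bullet> b"] 1 by (simp add: hpos algebra_simps)
      moreover have "(hi \<bullet> b) * (w \<bullet> b) \<le> (m \<bullet> b) * (w \<bullet> b)"
        using h[of "- (w \<bullet> b)"] 1 by (simp add: hpos)
      ultimately have "m \<bullet> b = hi \<bullet> b" using 1 by simp
      then show ?thesis using 1 lo_le_hi[OF b] by simp
    next
      case 2
      have "(m \<bullet> b) * (w \<bullet> b) \<le> (lo \<bullet> b) * (w \<bullet> b)"
        using h[of "w \<bullet> b"] 2 by (simp add: hneg algebra_simps)
      moreover have "(lo \<bullet> b) * (w \<bullet> b) \<le> (m \<bullet> b) * (w \<bullet> b)"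
        using h[of "- (w \<bullet> b)"] 2 by (simp add: hneg)
      ultimately have "m \<bullet> b = lo \<bullet> b" using 2 by simp
      then show ?thesis using 2 lo_le_hi[OF b] by simp
    next
      case 3
      then show ?thesis using h[of 1] h[of "- 1"] by (simp add: hpos hneg)
    qed
  qed
next
  assume comp: "complementary w m"
  show "\<forall>v. g w + m \<bullet> (v - w) \<le> g v"
  proof
    fix v
    have "max ((lo \<bullet> b) * (w \<bullet> b)) ((hi \<bullet> b) * (w \<bullet> b)) + (m \<bullet> b) * ((v - w) \<bullet> b)
        \<le> max ((lo \<bullet> b) * (v \<bullet> b)) ((hi \<bullet> b) * (v \<bullet> b))" if b: "b \<in> Basis" for b
    proof -
      have lh: "lo \<bullet> b \<le> m \<bullet> b" "m \<bullet> b \<le> hi \<bullet> b" using comp b unfolding complementary_def by auto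
      have "max ((lo \<bullet> b) * (w \<bullet> b)) ((hi \<bullet> b) * (w \<bullet> b)) = (m \<bullet> b) * (w \<bullet> b)"
      proof -
        consider "w \<bullet> b > 0" | "w \<bullet> b < 0" | "w \<bullet> b = 0" by linarith
        then show ?thesis
        proof cases
          case 1
          then have "m \<bullet> b = hi \<bullet> b" using comp b unfolding complementary_def by auto
          then show ?thesis using 1 lo_le_hi[OF b] by (simp add: max_absorb2 mult_right_mono)
        next
          case 2
          then have "m \<bullet> b = lo \<bullet> b" using comp b unfolding complementary_def by auto
          then show ?thesis using 2 lo_le_hi[OF b] by (simp add: max_absorb1 mult_right_mono_neg)
        qed simp
      qed
      moreover have "(m \<bullet> b) * (v \<bullet> b) \<le> max ((lo \<bullet> b) * (v \<bullet> b)) ((hi \<bullet> b) * (v \<bullet> b))"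
      proof (cases "v \<bullet> b \<ge> 0")
        case True
        then have "(m \<bullet> b) * (v \<bullet> b) \<le> (hi \<bullet> b) * (v \<bullet> b)" using lh by (intro mult_right_mono)
        then show ?thesis by simp
      next
        case False
        then have "(m \<bullet> b) * (v \<bullet> b) \<le> (lo \<bullet> b) * (v \<bullet> b)" using lh by (intro mult_right_mono_neg) auto
        then show ?thesis by simp
      qed
      ultimately show ?thesis by (simp add: inner_diff_left right_diff_distrib)
    qed
    then have "(\<Sum>b\<in>Basis. max ((lo \<bullet> b) * (w \<bullet> b)) ((hi \<bullet> b) * (w \<bullet> b)) + (m \<bullet> b) * ((v - w) \<bullet> b)) \<le> g v"
      unfolding g_eq by (intro sum_mono)
    then show "g w + m \<bullet> (v - w) \<le> g v"
      unfolding sum.distrib g_eq[of w, symmetric] euclidean_inner[of m "v - w", symmetric] .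
  qed
qed

text \<open>The function is a convex quadratic with gradient \<open>Q z + adjoint M v\<close>; over
  a subspace, minimality means that the gradient is orthogonal to it.\<close>

lemma stationary_iff:
  assumes "z \<in> S"
  shows "(\<forall>w\<in>S. f z + v \<bullet> M z \<le> f w + v \<bullet> M w) \<longleftrightarrow> (\<forall>d\<in>S. (Q z + adjoint M v) \<bullet> d = 0)"
proof -
  have expand: "f (z + d) + v \<bullet> M (z + d) = f z + v \<bullet> M z + (Q z + adjoint M v) \<bullet> d + (1/2) * (Q d \<bullet> d)" for d
  proof -
    have "adjoint M v \<bullet> d = v \<bullet> M d" using adjoint_works[OF linear_M, of d v] by (simp add: inner_commute)
    moreover have "Q d \<bullet> z = Q z \<bullet> d" by (metis Q_sym inner_commute)
    ultimately show ?thesis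
      by (simp add: f_eq linear_add[OF linear_M] linear_add[OF linear_Q] inner_add_left inner_add_right algebra_simps)
  qed
  show ?thesis
  proof
    assume min: "\<forall>w\<in>S. f z + v \<bullet> M z \<le> f w + v \<bullet> M w"
    show "\<forall>d\<in>S. (Q z + adjoint M v) \<bullet> d = 0"
    proof (intro ballI, rule ccontr)
      fix d assume d: "d \<in> S" and nz: "(Q z + adjoint M v) \<bullet> d \<noteq> 0"
      define A where "A = (Q z + adjoint M v) \<bullet> d"
      define B where "B = Q d \<bullet> d + 1"
      have B: "B > 0" using Q_psd[of d] by (simp add: B_def)
      have quad: "0 \<le> t * A + (1/2) * t\<^sup>2 * (Q d \<bullet> d)" for t
      proof -
        have "z + t *\<^sub>R d \<in> S" using assms d subspace_S by (simp add: subspace_add subspace_scale)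
        from min[rule_format, OF this] show ?thesis
          unfolding expand by (simp add: A_def linear_cmul[OF linear_Q] power2_eq_square algebra_simps)
      qed
      have "(1/2) * t\<^sup>2 * (Q d \<bullet> d) \<le> (1/2) * t\<^sup>2 * B" for t by (intro mult_left_mono) (auto simp: B_def)
      then have "0 \<le> t * A + (1/2) * t\<^sup>2 * B" for t using quad[of t] by (meson add_left_mono order_trans)
      \<comment> \<open>The minimiser of the quadratic majorant; the 1 in \<open>B\<close> makes it
        well defined when \<open>Q d \<bullet> d\<close> vanishes.\<close>
      from this[of "- A / B"] have "0 \<le> - (A * A / B) / 2"
        using B by (simp add: power2_eq_square field_simps)
      moreover have "A * A / B > 0" using B nz unfolding A_def[symmetric] by (intro divide_pos_pos) (auto simp: zero_less_mult_iff)
      ultimately show False by simp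
    qed
  next
    assume orth: "\<forall>d\<in>S. (Q z + adjoint M v) \<bullet> d = 0"
    show "\<forall>w\<in>S. f z + v \<bullet> M z \<le> f w + v \<bullet> M w"
    proof
      fix w assume "w \<in> S"
      then have "w - z \<in> S" using assms subspace_S by (simp add: subspace_diff)
      then show "f z + v \<bullet> M z \<le> f w + v \<bullet> M w"
        using expand[of "w - z"] orth Q_psd[of "w - z"] by simp
    qed
  qed
qed

lemma saddle_iff:
  "saddle xs ls \<longleftrightarrow> xs \<in> S \<and> (\<forall>d\<in>S. (Q xs + adjoint M ls) \<bullet> d = 0) \<and> complementary (M xs + c) ls"
  unfolding saddle_def using stationary_iff g_subgradient_iff by blast

lemma iterate_complementary: "complementary (y (Suc k)) (l (Suc k))"
  using y_variational g_subgradient_iff by blast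

lemma iterate_stationary:
  assumes "d \<in> S"
  shows "(Q (x (Suc k)) + adjoint M (M (x (Suc k)) + c - y k + l k)) \<bullet> d = 0"
proof -
  have "\<forall>w\<in>S. f (x (Suc k)) + (M (x (Suc k)) + c - y k + l k) \<bullet> M (x (Suc k))
      \<le> f w + (M (x (Suc k)) + c - y k + l k) \<bullet> M w"
  proof
    fix w assume "w \<in> S"
    from x_variational[OF this, of k]
    show "f (x (Suc k)) + (M (x (Suc k)) + c - y k + l k) \<bullet> M (x (Suc k))
      \<le> f w + (M (x (Suc k)) + c - y k + l k) \<bullet> M w"
      unfolding inner_diff_right by linarith
  qed
  then show ?thesis using stationary_iff[OF x_mem] assms by blast
qed

text \<open>The graph of the subdifferential of \<open>g\<close> is a finite union of boxes, and the remaining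
  optimality conditions are linear equations.\<close>

lemma optimality_error_bound:
  assumes ex: "saddle x0 l0"
  obtains \<kappa> where "\<And>k. \<exists>xs ls. saddle xs ls \<and>
    norm (s (Suc k) - (M xs + c + ls)) \<le> \<kappa> * norm (s (Suc (Suc k)) - s (Suc k))"
proof -
  \<comment> \<open>\<open>I\<close> and \<open>J\<close> select the pieces with \<open>m\<close> at
    \<open>hi\<close> and at \<open>lo\<close>; on the remaining coordinates \<open>w\<close> is
    zero. Equalities are written as pairs of inequalities, so every condition is a coordinate bound.
    The component \<open>z\<close> is free, since membership in \<open>S\<close> becomes an
    equation.\<close>
  define box :: "'b set \<times> 'b set \<Rightarrow> ('a \<times> 'b \<times> 'b) set" where
    "box = (\<lambda>(I, J). {(z, w, m). \<forall>b\<in>Basis. lo \<bullet> b \<le> m \<bullet> b \<and> m \<bullet> b \<le> hi \<bullet> b \<and>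
       (b \<in> I \<longrightarrow> 0 \<le> w \<bullet> b \<and> hi \<bullet> b \<le> m \<bullet> b) \<and> (b \<in> J \<longrightarrow> w \<bullet> b \<le> 0 \<and> m \<bullet> b \<le> lo \<bullet> b) \<and>
       (b \<notin> I \<union> J \<longrightarrow> 0 \<le> w \<bullet> b \<and> w \<bullet> b \<le> 0)})"
  define \<B> where "\<B> = box ` (Pow Basis \<times> Pow Basis)"
  have fin: "finite \<B>" unfolding \<B>_def by simp
  have comp: "(z, w, m) \<in> \<Union>\<B> \<longleftrightarrow> complementary w m" for z w m
  proof
    assume "(z, w, m) \<in> \<Union>\<B>"
    then obtain I J where "(z, w, m) \<in> box (I, J)" unfolding \<B>_def by auto
    then have "lo \<bullet> b \<le> m \<bullet> b \<and> m \<bullet> b \<le> hi \<bullet> b \<and> (w \<bullet> b > 0 \<longrightarrow> m \<bullet> b = hi \<bullet> b) \<and> (w \<bullet> b < 0 \<longrightarrow> m \<bullet> b = lo \<bullet> b)"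
      if "b \<in> Basis" for b
      using that unfolding box_def by (cases "b \<in> I"; cases "b \<in> J") force+
    then show "complementary w m" unfolding complementary_def by blast
  next
    assume "complementary w m"
    then have "(z, w, m) \<in> box ({b\<in>Basis. w \<bullet> b > 0}, {b\<in>Basis. w \<bullet> b < 0})"
      unfolding box_def complementary_def by (auto simp: not_less)
    then show "(z, w, m) \<in> \<Union>\<B>" unfolding \<B>_def by (rule UnionI[OF imageI, rotated]) auto
  qed
  have closed_interval: "closed B \<and> is_interval B" if "B \<in> \<B>" for B
  proof -
    obtain I J where B: "B = box (I, J)" using \<open>B \<in> \<B>\<close> unfolding \<B>_def by auto
    have "closed B"
      unfolding B box_def Ball_def case_prod_beta prod.sel
      by (intro closed_Collect_all closed_Collect_imp closed_Collect_conj closed_Collect_le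
        continuous_intros open_Collect_const)
    moreover have "is_interval B"
      unfolding is_interval_def
    proof (intro ballI allI impI)
      fix p p' r assume pB: "p \<in> B" "p' \<in> B"
        and between: "\<forall>i\<in>Basis. p \<bullet> i \<le> r \<bullet> i \<and> r \<bullet> i \<le> p' \<bullet> i \<or> p' \<bullet> i \<le> r \<bullet> i \<and> r \<bullet> i \<le> p \<bullet> i"
      obtain z w m z' w' m' z'' w'' m'' where
        e: "p = (z, w, m)" "p' = (z', w', m')" "r = (z'', w'', m'')" by (metis prod_cases3)
      have bw: "w \<bullet> b \<le> w'' \<bullet> b \<and> w'' \<bullet> b \<le> w' \<bullet> b \<or> w' \<bullet> b \<le> w'' \<bullet> b \<and> w'' \<bullet> b \<le> w \<bullet> b" if "b \<in> Basis" for b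
        using between[rule_format, of "(0, b, 0)"] that by (simp add: e Basis_prod_def zero_prod_def)
      have bm: "m \<bullet> b \<le> m'' \<bullet> b \<and> m'' \<bullet> b \<le> m' \<bullet> b \<or> m' \<bullet> b \<le> m'' \<bullet> b \<and> m'' \<bullet> b \<le> m \<bullet> b" if "b \<in> Basis" for b
        using between[rule_format, of "(0, 0, b)"] that by (simp add: e Basis_prod_def zero_prod_def)
      show "r \<in> B"
        unfolding B e box_def
      proof (simp, intro ballI)
        fix b :: 'b assume b: "b \<in> Basis"
        show "lo \<bullet> b \<le> m'' \<bullet> b \<and> m'' \<bullet> b \<le> hi \<bullet> b \<and>
           (b \<in> I \<longrightarrow> 0 \<le> w'' \<bullet> b \<and> hi \<bullet> b \<le> m'' \<bullet> b) \<and> (b \<in> J \<longrightarrow> w'' \<bullet> b \<le> 0 \<and> m'' \<bullet> b \<le> lo \<bullet> b) \<and>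
           (b \<notin> I \<and> b \<notin> J \<longrightarrow> 0 \<le> w'' \<bullet> b \<and> w'' \<bullet> b \<le> 0)"
        proof -
          have "lo \<bullet> b \<le> m \<bullet> b \<and> m \<bullet> b \<le> hi \<bullet> b \<and>
             (b \<in> I \<longrightarrow> 0 \<le> w \<bullet> b \<and> hi \<bullet> b \<le> m \<bullet> b) \<and> (b \<in> J \<longrightarrow> w \<bullet> b \<le> 0 \<and> m \<bullet> b \<le> lo \<bullet> b) \<and>
             (b \<notin> I \<and> b \<notin> J \<longrightarrow> 0 \<le> w \<bullet> b \<and> w \<bullet> b \<le> 0)"
            "lo \<bullet> b \<le> m' \<bullet> b \<and> m' \<bullet> b \<le> hi \<bullet> b \<and>
             (b \<in> I \<longrightarrow> 0 \<le> w' \<bullet> b \<and> hi \<bullet> b \<le> m' \<bullet> b) \<and> (b \<in> J \<longrightarrow> w' \<bullet> b \<le> 0 \<and> m' \<bullet> b \<le> lo \<bullet> b) \<and>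
             (b \<notin> I \<and> b \<notin> J \<longrightarrow> 0 \<le> w' \<bullet> b \<and> w' \<bullet> b \<le> 0)"
            using pB b unfolding B e box_def by simp_all
          then show ?thesis
            using bw[OF b] bm[OF b] by (elim disjE; cases "b \<in> I"; cases "b \<in> J"; simp)
        qed
      qed
    qed
    ultimately show ?thesis ..
  qed
  obtain q :: "'a \<Rightarrow> 'a" where q: "linear q" "\<And>w. q w = 0 \<longleftrightarrow> (\<forall>d\<in>S. w \<bullet> d = 0)"
    using orthogonality_kernel[OF subspace_S] by blast
  \<comment> \<open>Applied to the orthogonal complement, the construction has kernel
    \<open>S\<close>, by taking complements twice.\<close>
  obtain q' :: "'a \<Rightarrow> 'a" where q': "linear q'" "\<And>w. q' w = 0 \<longleftrightarrow> (\<forall>d\<in>S\<^sup>\<bottom>. w \<bullet> d = 0)"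
    using orthogonality_kernel[OF subspace_orthogonal_comp] by blast
  have q'S: "q' w = 0 \<longleftrightarrow> w \<in> S" for w
  proof -
    have "w \<in> S \<longleftrightarrow> w \<in> S\<^sup>\<bottom>\<^sup>\<bottom>" using orthogonal_comp_self[OF subspace_S] by simp
    also have "\<dots> \<longleftrightarrow> (\<forall>d\<in>S\<^sup>\<bottom>. w \<bullet> d = 0)"
      unfolding orthogonal_comp_def[of "S\<^sup>\<bottom>"] by (auto simp: orthogonal_def inner_commute)
    finally show ?thesis using q'(2) by simp
  qed
  \<comment> \<open>The components express feasibility of the split, stationarity in
    \<open>x\<close>, and membership in \<open>S\<close>.\<close>
  define G where "G = (\<lambda>(z, w, m). (M z - w, q (Q z + adjoint M m), q' z))"
  have linadj: "linear (adjoint M)" by (rule adjoint_linear[OF linear_M])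
  have linG: "linear G"
    by (rule linearI)
      (auto simp: G_def linear_add[OF linear_M] linear_add[OF linear_Q] linear_add[OF q(1)] linear_add[OF q'(1)]
        linear_add[OF linadj] linear_cmul[OF linear_M] linear_cmul[OF linear_Q] linear_cmul[OF q(1)]
        linear_cmul[OF q'(1)] linear_cmul[OF linadj] algebra_simps)
  define a where "a = (- c, 0::'a, 0::'a)"
  have sol: "z \<in> S \<and> w = M z + c \<and> saddle z m" if "G (z, w, m) = a" "(z, w, m) \<in> \<Union>\<B>" for z w m
  proof -
    have "M z - w = - c" "q (Q z + adjoint M m) = 0" "q' z = 0"
      using that(1) by (auto simp: G_def a_def)
    then have "w = M z + c" "\<forall>d\<in>S. (Q z + adjoint M m) \<bullet> d = 0" "z \<in> S"
      using q q'S by (auto simp: algebra_simps)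
    then show ?thesis using that(2) comp saddle_iff by blast
  qed
  have ne: "{z\<in>\<Union>\<B>. G z = a} \<noteq> {}"
  proof -
    have "(x0, M x0 + c, l0) \<in> \<Union>\<B>" using ex comp by (simp add: saddle_iff)
    moreover have "G (x0, M x0 + c, l0) = a" using ex q q'S by (simp add: saddle_iff G_def a_def)
    ultimately show ?thesis by blast
  qed
  \<comment> \<open>The \<open>x\<close> of the next step is paired with the current
    \<open>y\<close> and \<open>l\<close>: complementarity and membership in \<open>S\<close> then
    hold exactly, and the other two equations fail only by \<open>r\<close> and
    \<open>- q (adjoint M r)\<close>, where \<open>r\<close> is the increment of
    \<open>s\<close>.\<close>
  define T where "T = range (\<lambda>k. (x (Suc (Suc k)), y (Suc k), l (Suc k)))"
  have "bounded T"
  proof -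
    obtain By where By: "\<And>k. norm (y k) \<le> By" using y_bounded[OF ex] by blast
    obtain Bl where Bl: "\<And>k. norm (l k) \<le> Bl" using l_bounded[OF ex] by blast
    obtain Bs where Bs: "\<And>k. norm (s k) \<le> Bs" using s_bounded[OF ex] by blast
    obtain e where e: "e > 0" "\<And>z. e * norm z \<le> norm (M z)"
      using injective_imp_isometric[of UNIV M] linear_M inj_M
      by (auto simp: linear_conv_bounded_linear linear_injective_0)
    have Bx: "norm (x (Suc k)) \<le> (Bs + Bl + norm c) / e" for k
    proof -
      have "M (x (Suc k)) = s (Suc k) - l k - c" by (simp add: s_Suc)
      then have "norm (M (x (Suc k))) \<le> Bs + Bl + norm c"
        using norm_triangle_ineq4[of "s (Suc k) - l k" c] norm_triangle_ineq4[of "s (Suc k)" "l k"]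
          Bs[of "Suc k"] Bl[of k] by simp
      then show ?thesis using e(2)[of "x (Suc k)"] e(1) by (simp add: field_simps)
    qed
    have "norm (x (Suc (Suc k)), y (Suc k), l (Suc k)) \<le> (Bs + Bl + norm c) / e + (By + Bl)" for k
      using norm_Pair_le[of "x (Suc (Suc k))" "(y (Suc k), l (Suc k))"] norm_Pair_le[of "y (Suc k)" "l (Suc k)"]
        Bx[of "Suc k"] By[of "Suc k"] Bl[of "Suc k"] by linarith
    then show ?thesis unfolding T_def bounded_iff by blast
  qed
  then obtain \<kappa> where \<kappa>: "\<kappa> \<ge> 0" and
    bound: "\<And>z. z \<in> \<Union>\<B> \<Longrightarrow> z \<in> T \<Longrightarrow> \<exists>z'\<in>\<Union>\<B>. G z' = a \<and> norm (z - z') \<le> \<kappa> * norm (G z - a)"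
    using finite_intervals_error_bound[OF linG fin closed_interval _ ne] by blast
  have "linear (\<lambda>v. q (adjoint M v))" using linear_compose[OF linadj q(1)] by (simp add: o_def)
  then obtain C where C: "C > 0" "\<And>v. norm (q (adjoint M v)) \<le> C * norm v"
    using linear_bounded_pos by blast
  show thesis
  proof (rule that)
    fix k
    define r where "r = s (Suc (Suc k)) - s (Suc k)"
    define z where "z = (x (Suc (Suc k)), y (Suc k), l (Suc k))"
    have r: "r = M (x (Suc (Suc k))) + c - y (Suc k)" by (simp add: r_def s_Suc[of "Suc k"] s_def[of "Suc k"])
    have "z \<in> \<Union>\<B>" "z \<in> T" using comp iterate_complementary by (auto simp: z_def T_def)
    then obtain xs w ls where z': "(xs, w, ls) \<in> \<Union>\<B>" "G (xs, w, ls) = a"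
      and dist: "norm (z - (xs, w, ls)) \<le> \<kappa> * norm (G z - a)"
      using bound by (metis prod_cases3)
    have sad: "saddle xs ls" "w = M xs + c" using sol z' by auto
    have "q (Q (x (Suc (Suc k))) + adjoint M (l (Suc k))) = - q (adjoint M r)"
    proof -
      have "q (Q (x (Suc (Suc k))) + adjoint M (r + l (Suc k))) = 0"
        using iterate_stationary[of _ "Suc k"] q(2) by (simp add: r)
      then show ?thesis
        by (simp add: linear_add[OF linadj] linear_add[OF q(1)] algebra_simps eq_neg_iff_add_eq_0)
    qed
    moreover have "q' (x (Suc (Suc k))) = 0" using q'S x_mem by simp
    ultimately have "G z - a = (r, - q (adjoint M r), 0)" by (simp add: G_def z_def a_def r)
    then have "norm (G z - a) \<le> norm r + norm (q (adjoint M r))"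
      using norm_Pair_le[of r "(- q (adjoint M r), 0::'a)"] norm_Pair_le[of "- q (adjoint M r)" "0::'a"] by simp
    also have "\<dots> \<le> (1 + C) * norm r" using C(2)[of r] by (simp add: algebra_simps)
    finally have "\<kappa> * norm (G z - a) \<le> \<kappa> * ((1 + C) * norm r)" using \<kappa> by (intro mult_left_mono)
    with dist have d1: "norm (z - (xs, w, ls)) \<le> \<kappa> * (1 + C) * norm r" by simp
    have "s (Suc k) - (M xs + c + ls) = (y (Suc k) - w) + (l (Suc k) - ls)" by (simp add: s_def sad)
    then have "norm (s (Suc k) - (M xs + c + ls)) \<le> norm (y (Suc k) - w) + norm (l (Suc k) - ls)"
      by (simp only: norm_triangle_ineq)
    also have "\<dots> \<le> 2 * norm (z - (xs, w, ls))"
    proof -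
      have "norm (y (Suc k) - w) \<le> norm (z - (xs, w, ls))" "norm (l (Suc k) - ls) \<le> norm (z - (xs, w, ls))"
        unfolding z_def diff_Pair
        by (rule order_trans[OF norm_fst_le norm_snd_le], rule order_trans[OF norm_snd_le norm_snd_le])
      then show ?thesis by simp
    qed
    also have "\<dots> \<le> (2 * (\<kappa> * (1 + C))) * norm r" using d1 by simp
    finally show "\<exists>xs ls. saddle xs ls \<and> norm (s (Suc k) - (M xs + c + ls))
        \<le> (2 * (\<kappa> * (1 + C))) * norm (s (Suc (Suc k)) - s (Suc k))"
      using sad unfolding r_def by blast
  qed
qed

text \<open>Everything is read off from \<open>s\<close>: \<open>y\<close> is a nonexpansive
  function of it and inherits its bound in the limit, \<open>l\<close> is the difference, and a left
  inverse of \<open>M\<close> recovers \<open>x\<close> from \<open>s\<close> and the preceding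
  \<open>l\<close>.\<close>

theorem iterates_linearly_convergent:
  assumes ex: "saddle x0 l0"
  shows "linearly_convergent x" "linearly_convergent y" "linearly_convergent l"
proof -
  define Z where "Z = {M xs + c + ls | xs ls. saddle xs ls}"
  obtain \<kappa> where \<kappa>: "\<And>k. \<exists>xs ls. saddle xs ls \<and>
    norm (s (Suc k) - (M xs + c + ls)) \<le> \<kappa> * norm (s (Suc (Suc k)) - s (Suc k))"
    using optimality_error_bound[OF ex] by blast
  have s: "linearly_convergent (\<lambda>k. s (Suc k))"
  proof (rule Fejer_error_bound_linearly_convergent)
    show "(norm (s (Suc (Suc k)) - z))\<^sup>2 + (norm (s (Suc (Suc k)) - s (Suc k)))\<^sup>2
        \<le> (norm (s (Suc k) - z))\<^sup>2" if "z \<in> Z" for k z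
      using that s_Fejer unfolding Z_def by blast
    show "\<exists>z\<in>Z. norm (s (Suc k) - z) \<le> \<kappa> * norm (s (Suc (Suc k)) - s (Suc k))" for k
      using \<kappa>[of k] unfolding Z_def by blast
  qed
  have "linearly_convergent (\<lambda>k. y (Suc k))"
  proof -
    obtain ss C r where r: "0 \<le> r" "r < 1" and ss: "\<And>k. norm (s (Suc k) - ss) \<le> C * r ^ k"
      using s unfolding linearly_convergent_def by blast
    have lim: "(\<lambda>k. s (Suc k)) \<longlonglongrightarrow> ss"
    proof (rule Lim_transform_bound[of "\<lambda>k. s (Suc k) - ss" "\<lambda>k. C * r ^ k", THEN LIM_zero_cancel])
      show "(\<lambda>k. C * r ^ k) \<longlonglongrightarrow> 0" using r by (intro tendsto_mult_right_zero LIMSEQ_realpow_zero)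
      show "\<forall>\<^sub>F k in sequentially. norm (s (Suc k) - ss) \<le> norm (C * r ^ k)"
        using ss order_trans[OF ss abs_ge_self] by (intro always_eventually) auto
    qed
    have "Cauchy (\<lambda>k. y (Suc k))"
    proof (rule metric_CauchyI)
      fix e :: real assume "e > 0"
      then obtain N where "\<forall>m\<ge>N. \<forall>n\<ge>N. dist (s (Suc m)) (s (Suc n)) < e"
        using LIMSEQ_imp_Cauchy[OF lim] metric_CauchyD by blast
      then show "\<exists>N. \<forall>m\<ge>N. \<forall>n\<ge>N. dist (y (Suc m)) (y (Suc n)) < e"
        using y_nonexpansive unfolding dist_norm by (meson order_le_less_trans)
    qed
    then obtain ys where ys: "(\<lambda>k. y (Suc k)) \<longlonglongrightarrow> ys" using Cauchy_convergent_iff convergent_def by blast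
    have "norm (y (Suc k) - ys) \<le> C * r ^ k" for k
    proof -
      have "(\<lambda>m. norm (y (Suc k) - y (Suc m))) \<longlonglongrightarrow> norm (y (Suc k) - ys)" by (intro tendsto_intros ys)
      moreover have "(\<lambda>m. norm (s (Suc k) - s (Suc m))) \<longlonglongrightarrow> norm (s (Suc k) - ss)" by (intro tendsto_intros lim)
      ultimately have "norm (y (Suc k) - ys) \<le> norm (s (Suc k) - ss)"
        by (rule LIMSEQ_le) (use y_nonexpansive in blast)
      then show ?thesis using ss[of k] by linarith
    qed
    then show ?thesis using r by (intro linearly_convergentI)
  qed
  then show y: "linearly_convergent y" by (rule linearly_convergent_of_Suc)
  have "linearly_convergent s" using s by (rule linearly_convergent_of_Suc)
  from linearly_convergent_diff[OF this y] show l: "linearly_convergent l" by (simp add: s_def)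
  obtain N where N: "linear N" "N \<circ> M = id" using linear_injective_left_inverse[OF linear_M inj_M] by blast
  have "linearly_convergent (\<lambda>k. s (Suc k) - l k - c)"
    using s l by (intro linearly_convergent_diff linearly_convergent_const)
  then have "linearly_convergent (\<lambda>k. N (s (Suc k) - l k - c))"
    by (rule linearly_convergent_bounded_linear[rotated]) (use N(1) in \<open>simp add: linear_conv_bounded_linear\<close>)
  moreover have "N (s (Suc k) - l k - c) = x (Suc k)" for k
    using fun_cong[OF N(2), of "x (Suc k)"] by (simp add: s_Suc)
  ultimately have "linearly_convergent (\<lambda>k. x (Suc k))" by simp
  then show "linearly_convergent x" by (rule linearly_convergent_of_Suc)
qed

end

section \<open>The support vector machine problems\<close>

lemma sublinear_convex_on:
  fixes N :: "'a::real_vector \<Rightarrow> real"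
  assumes "\<And>u v. N (u + v) \<le> N u + N v" and "\<And>t u. t \<ge> 0 \<Longrightarrow> N (t *\<^sub>R u) = t * N u"
  shows "convex_on UNIV N"
proof (rule convex_onI)
  fix t :: real and u v :: 'a
  assume "0 < t" "t < 1"
  then show "N ((1 - t) *\<^sub>R u + t *\<^sub>R v) \<le> (1 - t) * N u + t * N v"
    using assms(1)[of "(1 - t) *\<^sub>R u" "t *\<^sub>R v"] by (simp add: assms(2))
qed simp

lemma convex_on_compose_affine:
  assumes "convex_on UNIV h" and T: "linear T"
  shows "convex_on UNIV (\<lambda>x. h (T x + c))"
proof (rule convex_onI)
  fix t :: real and u v
  assume t: "0 < t" "t < 1"
  have "T ((1 - t) *\<^sub>R u + t *\<^sub>R v) + c = (1 - t) *\<^sub>R (T u + c) + t *\<^sub>R (T v + c)"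
    by (simp add: linear_add[OF T] linear_cmul[OF T] linear_diff[OF T] scaleR_add_right scaleR_left_diff_distrib)
  then show "h (T ((1 - t) *\<^sub>R u + t *\<^sub>R v) + c) \<le> (1 - t) * h (T u + c) + t * h (T v + c)"
    using convex_onD[OF assms(1), of t "T u + c" "T v + c"] t by simp
qed simp

lemma convex_on_compose_linear:
  assumes "convex_on UNIV h" "linear T"
  shows "convex_on UNIV (\<lambda>x. h (T x))"
  using convex_on_compose_affine[OF assms, of 0] by simp

lemma convex_on_norm_square: "convex_on UNIV (\<lambda>x::'a::real_inner. (norm x)\<^sup>2)"
proof (rule convex_onI)
  fix t :: real and u v :: 'a
  assume t: "0 < t" "t < 1"
  have "(1 - t) * (norm u)\<^sup>2 + t * (norm v)\<^sup>2 - (norm ((1 - t) *\<^sub>R u + t *\<^sub>R v))\<^sup>2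
      = t * (1 - t) * (norm (u - v))\<^sup>2"
    unfolding power2_norm_eq_inner
    by (simp add: inner_add_left inner_add_right inner_diff_left inner_diff_right inner_commute algebra_simps)
  moreover have "0 \<le> t * (1 - t) * (norm (u - v))\<^sup>2" using t by simp
  ultimately show "(norm ((1 - t) *\<^sub>R u + t *\<^sub>R v))\<^sup>2 \<le> (1 - t) * (norm u)\<^sup>2 + t * (norm v)\<^sup>2" by linarith
qed simp

lemma convex_on_sum_functions:
  fixes h :: "'i \<Rightarrow> 'a::real_vector \<Rightarrow> real"
  assumes "\<And>i. i \<in> I \<Longrightarrow> convex_on UNIV (h i)"
  shows "convex_on UNIV (\<lambda>x. \<Sum>i\<in>I. h i x)"
proof (rule convex_onI)
  fix t :: real and u v :: 'a
  assume "0 < t" "t < 1"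
  then have "(\<Sum>i\<in>I. h i ((1 - t) *\<^sub>R u + t *\<^sub>R v)) \<le> (\<Sum>i\<in>I. (1 - t) * h i u + t * h i v)"
    using convex_onD[OF assms] by (intro sum_mono) auto
  then show "(\<Sum>i\<in>I. h i ((1 - t) *\<^sub>R u + t *\<^sub>R v)) \<le> (1 - t) * (\<Sum>i\<in>I. h i u) + t * (\<Sum>i\<in>I. h i v)"
    by (simp add: sum.distrib sum_distrib_left)
qed simp

section \<open>Convexity of the loss and the regularisers, and their comparison with the Frobenius
  norm\<close>

lemma pos_part_nonneg: "pos_part t \<ge> 0"
  by (simp add: pos_part_def)

lemma pos_part_add: "pos_part (s + t) \<le> pos_part s + pos_part t"
  by (simp add: pos_part_def)

lemma pos_part_mult: "c \<ge> 0 \<Longrightarrow> pos_part (c * t) = c * pos_part t"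
  by (simp add: pos_part_def max_mult_distrib_left)

lemma cost_nonneg: "cost y i j \<ge> 0"
  by (simp add: cost_def)

lemma hinge_loss_nonneg: "hinge_loss y A \<ge> 0"
  unfolding hinge_loss_def by (intro mult_nonneg_nonneg sum_nonneg cost_nonneg pos_part_nonneg) simp

lemma hinge_loss_mono:
  assumes "\<And>i j. cost y i j * pos_part (A $ i $ j) \<le> cost y i j * pos_part (B $ i $ j)"
  shows "hinge_loss y A \<le> hinge_loss y B"
  unfolding hinge_loss_def by (intro mult_left_mono sum_mono assms) simp

lemma hinge_loss_convex: "convex_on UNIV (hinge_loss (y :: 'n::finite \<Rightarrow> 'J::finite))"
proof (rule sublinear_convex_on)
  fix A B :: "real^'J^'n"
  have "(\<Sum>i\<in>UNIV. \<Sum>j\<in>UNIV. cost y i j * pos_part ((A + B) $ i $ j))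
      \<le> (\<Sum>i\<in>UNIV. \<Sum>j\<in>UNIV. cost y i j * pos_part (A $ i $ j) + cost y i j * pos_part (B $ i $ j))"
    unfolding distrib_left[symmetric] vector_add_component
    by (intro sum_mono mult_left_mono pos_part_add cost_nonneg)
  then have "(1 / real CARD('n)) * (\<Sum>i\<in>UNIV. \<Sum>j\<in>UNIV. cost y i j * pos_part ((A + B) $ i $ j))
      \<le> (1 / real CARD('n)) * (\<Sum>i\<in>UNIV. \<Sum>j\<in>UNIV. cost y i j * pos_part (A $ i $ j) + cost y i j * pos_part (B $ i $ j))"
    by (rule mult_left_mono) simp
  then show "hinge_loss y (A + B) \<le> hinge_loss y A + hinge_loss y B"
    unfolding hinge_loss_def by (simp only: sum.distrib distrib_left)
next
  fix t :: real and A :: "real^'J^'n"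
  assume "t \<ge> 0"
  then show "hinge_loss y (t *\<^sub>R A) = t * hinge_loss y A"
    unfolding hinge_loss_def by (simp add: pos_part_mult sum_distrib_left mult_ac)
qed

lemma l1_mat_convex: "convex_on UNIV (l1_mat :: real^'c^'r \<Rightarrow> real)"
proof (rule sublinear_convex_on)
  fix A B :: "real^'c^'r"
  show "l1_mat (A + B) \<le> l1_mat A + l1_mat B"
    unfolding l1_mat_def sum.distrib[symmetric] by (intro sum_mono) (simp add: abs_triangle_ineq)
qed (simp add: l1_mat_def abs_mult sum_distrib_left)

lemma l1_mat_nonneg: "l1_mat A \<ge> 0"
  unfolding l1_mat_def by (intro sum_nonneg) auto

lemma norm_le_sum_rows: "norm (A :: ('a::real_normed_vector)^'r) \<le> (\<Sum>i\<in>UNIV. norm (A $ i))"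
  unfolding norm_vec_def by (rule L2_set_le_sum) simp

lemma norm_le_l1_mat: "norm A \<le> l1_mat A"
  unfolding l1_mat_def by (rule order_trans[OF norm_le_sum_rows sum_mono[OF norm_le_l1_cart]])

lemma lq_norm_2: "lq_norm 2 v = norm v"
proof -
  have "real_of_ereal 2 = 2" by (metis numeral_eq_ereal real_of_ereal.simps(1))
  moreover have "(\<Sum>j\<in>UNIV. \<bar>v $ j\<bar> powr 2) = (norm v)\<^sup>2"
    by (simp add: norm_vec_def L2_set_def sum_nonneg powr_numeral)
  ultimately show ?thesis by (simp add: lq_norm_def powr_half_sqrt)
qed

lemma lq_norm_infinity: "lq_norm \<infinity> v = Max (range (\<lambda>j. \<bar>v $ j\<bar>))"
  by (simp add: lq_norm_def)

lemma lq_norm_convex: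
  assumes "q = 2 \<or> q = \<infinity>"
  shows "convex_on UNIV (lq_norm q :: real^'J \<Rightarrow> real)"
proof (cases "q = 2")
  case True
  show ?thesis unfolding True by (intro sublinear_convex_on; unfold lq_norm_2) (auto simp: norm_triangle_ineq)
next
  case False
  then have q: "q = \<infinity>" using assms by simp
  show ?thesis
    unfolding q
  proof (rule sublinear_convex_on)
    fix u v :: "real^'J"
    have "\<bar>(u + v) $ j\<bar> \<le> Max (range (\<lambda>j. \<bar>u $ j\<bar>)) + Max (range (\<lambda>j. \<bar>v $ j\<bar>))" for j
    proof -
      have "\<bar>u $ j\<bar> \<le> Max (range (\<lambda>j. \<bar>u $ j\<bar>))" "\<bar>v $ j\<bar> \<le> Max (range (\<lambda>j. \<bar>v $ j\<bar>))"
        by (auto intro: Max_ge)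
      then show ?thesis using abs_triangle_ineq[of "u $ j" "v $ j"] unfolding vector_add_component by linarith
    qed
    then show "lq_norm \<infinity> (u + v) \<le> lq_norm \<infinity> u + lq_norm \<infinity> v"
      by (auto simp: lq_norm_infinity)
  next
    fix t :: real and u :: "real^'J"
    assume t: "t \<ge> 0"
    have "mono ((*) t)" using t by (simp add: mono_def mult_left_mono)
    then have "t * Max (range (\<lambda>j. \<bar>u $ j\<bar>)) = Max ((*) t ` range (\<lambda>j. \<bar>u $ j\<bar>))"
      by (intro mono_Max_commute) auto
    then show "lq_norm \<infinity> (t *\<^sub>R u) = t * lq_norm \<infinity> u"
      using t by (simp add: lq_norm_infinity abs_mult image_image)
  qed
qed

text \<open>The factor is dictated by the maximum norm, through the sum of the moduli; at
  \<open>q = 2\<close> it is merely slack. The bound supplies coercivity of the row-norm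
  penalty.\<close>

lemma norm_le_lq_norm:
  fixes v :: "real^'J"
  assumes "q = 2 \<or> q = \<infinity>"
  shows "norm v \<le> real CARD('J) * lq_norm q v"
proof (cases "q = 2")
  case True
  have "1 * norm v \<le> real CARD('J) * norm v" by (intro mult_right_mono) (auto simp: Suc_leI)
  then show ?thesis unfolding True lq_norm_2 by simp
next
  case False
  have "norm v \<le> (\<Sum>j\<in>UNIV. \<bar>v $ j\<bar>)" by (rule norm_le_l1_cart)
  also have "\<dots> \<le> (\<Sum>j\<in>(UNIV::'J set). Max (range (\<lambda>j. \<bar>v $ j\<bar>)))" by (intro sum_mono Max_ge) auto
  finally show ?thesis using False assms by (auto simp: lq_norm_infinity)
qed

lemma linear_matrix_mult_left: "linear (\<lambda>W :: real^'c^'b. (A :: real^'b^'a) ** W)"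
  by (rule linearI) (auto simp: matrix_add_ldistrib matrix_scalar_ac scalar_matrix_assoc)

lemma linear_ebT: "linear ebT"
  by (rule linearI) (auto simp: ebT_def vec_eq_iff)

lemma subspace_Dset: "subspace Dset"
  unfolding Dset_def subspace_def
  by (auto simp: sum.distrib sum_distrib_left[symmetric] zero_prod_def)

section \<open>Existence of minimisers\<close>

text \<open>Without a penalty, \<open>W\<close> can be unbounded at bounded loss, for instance when
  margins become very negative. The margin matrix is split into nonnegative parts \<open>P\<close>
  and \<open>N\<close>, and \<open>(W, P, N)\<close> is shrunk coordinatewise. Both parts stay
  nonnegative, so the new \<open>P'\<close> still dominates the positive part of the new margins,
  while its weighted entries, and hence the bound on the loss, are unchanged.\<close>

lemma hinge_loss_bounded_representative:
  fixes X :: "real^'n^'p" and y :: "'n \<Rightarrow> 'J::finite"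
  obtains K where "K \<ge> 0" "\<And>W b. (W, b) \<in> Dset \<Longrightarrow> \<exists>W'. (W', b) \<in> Dset \<and>
    hinge_loss y (transpose X ** W' + ebT b + ones_mat) \<le> hinge_loss y (transpose X ** W + ebT b + ones_mat) \<and>
    norm W' \<le> K * (hinge_loss y (transpose X ** W + ebT b + ones_mat) + norm b + 1)"
proof -
  \<comment> \<open>Only quantities controlled by the loss and \<open>b\<close> are preserved: the
    margin equation, the entries of \<open>P\<close> that carry a cost, and the row sums. The
    weighted entries add up to the number of samples times the loss.\<close>
  define L :: "(real^'J^'p) \<times> (real^'J^'n) \<times> (real^'J^'n) \<Rightarrow> (real^'J^'n) \<times> (real^'J^'n) \<times> (real^'p)" where
    "L = (\<lambda>(W, P, N). (transpose X ** W - P + N, (\<chi> i j. cost y i j * P $ i $ j), (\<chi> i. \<Sum>j\<in>UNIV. W $ i $ j)))"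
  have "linear L"
    by (rule linearI)
      (auto simp: L_def linear_add[OF linear_matrix_mult_left] linear_cmul[OF linear_matrix_mult_left]
        vec_eq_iff sum.distrib sum_distrib_left algebra_simps)
  then obtain K where K: "K \<ge> 0"
    "\<And>d. \<exists>v. (\<forall>b\<in>Basis. min 0 (d \<bullet> b) \<le> v \<bullet> b \<and> v \<bullet> b \<le> max 0 (d \<bullet> b)) \<and> L v = L d \<and> norm v \<le> K * norm (L d)"
    using coordinatewise_Hoffman by blast
  obtain k where k: "k > 0" "\<And>b::real^'J. norm (ebT b :: real^'J^'n) \<le> k * norm b"
    using linear_bounded_pos[OF linear_ebT] by blast
  define o1 where "o1 = norm (ones_mat :: real^'J^'n)"
  define K' where "K' = K * (k + o1 + real CARD('n))"
  have o1: "o1 \<ge> 0" by (simp add: o1_def)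
  show thesis
  proof (rule that)
    show "K' \<ge> 0" using K k o1 by (simp add: K'_def)
    fix W :: "real^'J^'p" and b :: "real^'J"
    assume D: "(W, b) \<in> Dset"
    define A where "A = transpose X ** W + ebT b + ones_mat"
    define P where "P = (\<chi> i j. pos_part (A $ i $ j))"
    define N where "N = (\<chi> i j. pos_part (- A $ i $ j))"
    have PN: "P - N = A" by (auto simp: vec_eq_iff P_def N_def pos_part_def max_def)
    have Lval: "L (W, P, N) = (- (ebT b + ones_mat), (\<chi> i j. cost y i j * P $ i $ j), 0)"
      using D PN[symmetric] by (simp add: L_def A_def Dset_def vec_eq_iff algebra_simps)
    obtain W' P' N' where
      box: "\<And>e. e \<in> Basis \<Longrightarrow> min 0 ((W, P, N) \<bullet> e) \<le> (W', P', N') \<bullet> e \<and> (W', P', N') \<bullet> e \<le> max 0 ((W, P, N) \<bullet> e)"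
      and L': "L (W', P', N') = L (W, P, N)" and bd: "norm (W', P', N') \<le> K * norm (L (W, P, N))"
      using K(2)[of "(W, P, N)"] by (metis prod_cases3)
    have P': "P' $ i $ j \<ge> 0" and N': "N' $ i $ j \<ge> 0" for i j
    proof -
      have "(0, axis i (axis j 1), 0) \<in> (Basis :: ((real^'J^'p) \<times> (real^'J^'n) \<times> (real^'J^'n)) set)"
        "(0, 0, axis i (axis j 1)) \<in> (Basis :: ((real^'J^'p) \<times> (real^'J^'n) \<times> (real^'J^'n)) set)"
        by (auto simp: Basis_prod_def zero_prod_def)
      from box[OF this(1)] box[OF this(2)] show "P' $ i $ j \<ge> 0" "N' $ i $ j \<ge> 0"
        by (auto simp: inner_axis P_def N_def pos_part_nonneg)
    qed
    have eqs: "transpose X ** W' - P' + N' = - (ebT b + ones_mat)"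
      "\<And>i j. cost y i j * P' $ i $ j = cost y i j * P $ i $ j" "\<And>i. (\<Sum>j\<in>UNIV. W' $ i $ j) = 0"
      using L' unfolding Lval by (auto simp: L_def vec_eq_iff)
    have "(W', b) \<in> Dset" using D eqs(3) by (simp add: Dset_def)
    moreover have "hinge_loss y (transpose X ** W' + ebT b + ones_mat) \<le> hinge_loss y A"
    proof (rule hinge_loss_mono)
      fix i j
      have "transpose X ** W' + ebT b + ones_mat = P' - N'" using eqs(1) by (simp add: algebra_simps eq_neg_iff_add_eq_0)
      then have "pos_part ((transpose X ** W' + ebT b + ones_mat) $ i $ j) \<le> P' $ i $ j"
        using P'[of i j] N'[of i j] by (simp add: pos_part_def)
      then have "cost y i j * pos_part ((transpose X ** W' + ebT b + ones_mat) $ i $ j) \<le> cost y i j * P' $ i $ j"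
        by (intro mult_left_mono cost_nonneg)
      also have "\<dots> = cost y i j * pos_part (A $ i $ j)" by (simp add: eqs(2) P_def)
      finally show "cost y i j * pos_part ((transpose X ** W' + ebT b + ones_mat) $ i $ j)
          \<le> cost y i j * pos_part (A $ i $ j)" .
    qed
    moreover have "norm W' \<le> K' * (hinge_loss y A + norm b + 1)"
    proof -
      let ?c = "(\<chi> i j. cost y i j * P $ i $ j) :: real^'J^'n"
      have "norm ?c \<le> l1_mat ?c" by (rule norm_le_l1_mat)
      also have "\<dots> = real CARD('n) * hinge_loss y A"
        by (simp add: l1_mat_def hinge_loss_def P_def abs_mult cost_nonneg pos_part_nonneg)
      finally have c: "norm ?c \<le> real CARD('n) * hinge_loss y A" .
      have eb: "norm (- (ebT b + ones_mat) :: real^'J^'n) \<le> k * norm b + o1"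
        using norm_triangle_ineq[of "ebT b :: real^'J^'n" ones_mat] k(2)[of b] unfolding norm_minus_cancel o1_def by linarith
      have "norm (L (W, P, N)) \<le> norm (- (ebT b + ones_mat) :: real^'J^'n) + norm ?c"
        unfolding Lval using norm_Pair_le[of "- (ebT b + ones_mat) :: real^'J^'n" "(?c, 0::real^'p)"]
          norm_Pair_le[of ?c "0::real^'p"] unfolding norm_zero by linarith
      also have "\<dots> \<le> k * norm b + o1 + real CARD('n) * hinge_loss y A" using c eb by linarith
      also have "\<dots> \<le> (k + o1 + real CARD('n)) * (hinge_loss y A + norm b + 1)"
      proof -
        have "0 \<le> k * (hinge_loss y A + 1)" "0 \<le> o1 * (hinge_loss y A + norm b)" "0 \<le> real CARD('n) * (norm b + 1)"
          using k o1 hinge_loss_nonneg[of y A] by (auto intro!: mult_nonneg_nonneg)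
        then show ?thesis unfolding distrib_left distrib_right mult_1_right by linarith
      qed
      finally have "K * norm (L (W, P, N)) \<le> K * ((k + o1 + real CARD('n)) * (hinge_loss y A + norm b + 1))"
        using K(1) by (rule mult_left_mono)
      then show ?thesis
        using bd norm_fst_le[of W' "(P', N')"] unfolding K'_def by (simp add: mult.assoc)
    qed
    ultimately show "\<exists>W'. (W', b) \<in> Dset \<and>
      hinge_loss y (transpose X ** W' + ebT b + ones_mat) \<le> hinge_loss y (transpose X ** W + ebT b + ones_mat) \<and>
      norm W' \<le> K' * (hinge_loss y (transpose X ** W + ebT b + ones_mat) + norm b + 1)"
      unfolding A_def by blast
  qed
qed

text \<open>Below the level of the origin \<open>b\<close> is bounded through \<open>l3\<close>.
  \<open>W\<close> is bounded by coercivity or, when \<open>R\<close> vanishes, can be exchanged for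
  a bounded representative with the same \<open>b\<close>. Minimising over a compact set is then
  enough. The slack \<open>- e\<close> in the coercivity condition admits quadratic
  regularisers.\<close>

lemma svm_minimizer_exists:
  fixes X :: "real^'n^'p" and y :: "'n \<Rightarrow> 'J::finite" and R :: "real^'J^'p \<Rightarrow> real"
  assumes l3: "l3 > 0" and R: "convex_on UNIV R" "\<And>W. R W \<ge> 0"
    and coercive: "(\<forall>W. R W = 0) \<or> (\<exists>e>0. \<forall>W. e * norm W - e \<le> R W)"
  defines "\<Phi> \<equiv> \<lambda>W b. hinge_loss y (transpose X ** W + ebT b + ones_mat) + R W + (l3 / 2) * (norm b)\<^sup>2"
  obtains Ws bs where "(Ws, bs) \<in> Dset" "\<And>W b. (W, b) \<in> Dset \<Longrightarrow> \<Phi> Ws bs \<le> \<Phi> W b"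
proof -
  define H where "H W b = hinge_loss y (transpose X ** W + ebT b + ones_mat)" for W b
  have \<Phi>: "\<Phi> W b = H W b + R W + (l3 / 2) * (norm b)\<^sup>2" for W b by (simp add: \<Phi>_def H_def)
  have H0: "H W b \<ge> 0" for W b by (simp add: H_def hinge_loss_nonneg)
  have lin: "linear (\<lambda>x :: (real^'J^'p) \<times> (real^'J). transpose X ** fst x + ebT (snd x) :: real^'J^'n)"
    by (rule linearI)
      (auto simp: linear_add[OF linear_matrix_mult_left] linear_cmul[OF linear_matrix_mult_left]
        linear_add[OF linear_ebT] linear_cmul[OF linear_ebT] algebra_simps)
  have "convex_on UNIV (\<lambda>x. \<Phi> (fst x) (snd x))"
    unfolding \<Phi>_def
    by (intro convex_on_add convex_on_cmul convex_on_compose_affine[OF hinge_loss_convex lin]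
        convex_on_compose_linear[OF R(1) linear_fst] convex_on_compose_linear[OF convex_on_norm_square linear_snd])
      (use l3 in auto)
  then have cont: "continuous_on UNIV (\<lambda>x. \<Phi> (fst x) (snd x))" by (intro convex_on_continuous) auto
  define c0 where "c0 = \<Phi> 0 0"
  \<comment> \<open>From \<open>(l3 / 2) * (norm b)\<^sup>2 \<le> c0\<close> and the fact that a
    nonnegative number is at most 1 plus its square.\<close>
  define \<beta> where "\<beta> = 1 + 2 * c0 / l3"
  have c0: "c0 \<ge> 0" using H0[of 0 0] R(2)[of 0] by (simp add: c0_def \<Phi>)
  have bounds: "H W b \<le> c0" "R W \<le> c0" "norm b \<le> \<beta>" if "\<Phi> W b \<le> c0" for W b
  proof -
    have b2: "0 \<le> (l3 / 2) * (norm b)\<^sup>2" using l3 by simp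
    then show "H W b \<le> c0" "R W \<le> c0" using that H0[of W b] R(2)[of W] unfolding \<Phi> by linarith+
    have "(l3 / 2) * (norm b)\<^sup>2 \<le> c0" using that H0[of W b] R(2)[of W] unfolding \<Phi> by linarith
    then have "(norm b)\<^sup>2 \<le> 2 * c0 / l3" using l3 by (simp add: field_simps)
    moreover have "norm b \<le> 1 + (norm b)\<^sup>2"
      using sum_squares_ge_zero[of "norm b - 1" 0] norm_ge_zero[of b]
      unfolding power2_eq_square by (simp add: algebra_simps del: norm_ge_zero)
    ultimately show "norm b \<le> \<beta>" by (simp add: \<beta>_def)
  qed
  have "\<exists>\<rho>. \<forall>W b. (W, b) \<in> Dset \<longrightarrow> \<Phi> W b \<le> c0 \<longrightarrow>
      (\<exists>W'. (W', b) \<in> Dset \<and> \<Phi> W' b \<le> \<Phi> W b \<and> norm W' \<le> \<rho>)"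
    using coercive
  proof
    assume R0: "\<forall>W. R W = 0"
    obtain K where K: "K \<ge> 0" "\<And>W b. (W, b) \<in> Dset \<Longrightarrow> \<exists>W'. (W', b) \<in> Dset \<and> H W' b \<le> H W b \<and>
        norm W' \<le> K * (H W b + norm b + 1)"
      using hinge_loss_bounded_representative[of y X] unfolding H_def by blast
    have "\<exists>W'. (W', b) \<in> Dset \<and> \<Phi> W' b \<le> \<Phi> W b \<and> norm W' \<le> K * (c0 + \<beta> + 1)"
      if h: "(W, b) \<in> Dset" "\<Phi> W b \<le> c0" for W b
    proof -
      obtain W' where W': "(W', b) \<in> Dset" "H W' b \<le> H W b" "norm W' \<le> K * (H W b + norm b + 1)"
        using K(2)[OF h(1)] by blast
      have "K * (H W b + norm b + 1) \<le> K * (c0 + \<beta> + 1)"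
        using bounds[OF h(2)] K(1) by (intro mult_left_mono) auto
      then show ?thesis using W' R0 by (intro exI[of _ W']) (auto simp: \<Phi>)
    qed
    then show ?thesis by blast
  next
    assume "\<exists>e>0. \<forall>W. e * norm W - e \<le> R W"
    then obtain e where e: "e > 0" "\<And>W. e * norm W - e \<le> R W" by blast
    have "norm W \<le> c0 / e + 1" if "\<Phi> W b \<le> c0" for W b
      using e(1) e(2)[of W] bounds(2)[OF that] by (simp add: field_simps)
    then show ?thesis by blast
  qed
  then obtain \<rho> where \<rho>: "\<And>W b. (W, b) \<in> Dset \<Longrightarrow> \<Phi> W b \<le> c0 \<Longrightarrow>
      \<exists>W'. (W', b) \<in> Dset \<and> \<Phi> W' b \<le> \<Phi> W b \<and> norm W' \<le> \<rho>" by blast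
  \<comment> \<open>The absolute values keep the radius nonnegative, so \<open>T\<close> contains
    the origin, which beats every point above level \<open>c0\<close>.\<close>
  define T where "T = (Dset :: ((real^'J^'p) \<times> (real^'J)) set) \<inter> cball 0 (\<bar>\<rho>\<bar> + \<bar>\<beta>\<bar>)"
  have "compact T" unfolding T_def by (intro closed_Int_compact closed_subspace subspace_Dset) auto
  moreover have T0: "(0, 0) \<in> T" by (simp add: T_def Dset_def norm_Pair)
  ultimately obtain xs where xs: "xs \<in> T" "\<forall>x\<in>T. \<Phi> (fst xs) (snd xs) \<le> \<Phi> (fst x) (snd x)"
    using continuous_attains_inf[OF _ _ continuous_on_subset[OF cont]] by blast
  show thesis
  proof (rule that)
    show "(fst xs, snd xs) \<in> Dset" using xs(1) by (simp add: T_def)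
    fix W :: "real^'J^'p" and b assume D: "(W, b) \<in> Dset"
    show "\<Phi> (fst xs) (snd xs) \<le> \<Phi> W b"
    proof (cases "\<Phi> W b \<le> c0")
      case True
      obtain W' where W': "(W', b) \<in> Dset" "\<Phi> W' b \<le> \<Phi> W b" "norm W' \<le> \<rho>" using \<rho>[OF D True] by blast
      have "norm (W', b) \<le> \<bar>\<rho>\<bar> + \<bar>\<beta>\<bar>"
        using norm_Pair_le[of W' b] W'(3) bounds(3)[OF True] by linarith
      then have "(W', b) \<in> T" using W'(1) by (simp add: T_def)
      then show ?thesis using xs(2) W'(2) by fastforce
    next
      case False
      then show ?thesis using bspec[OF xs(2) T0] by (simp add: c0_def)
    qed
  qed
qed

section \<open>Rescaling to unit penalty\<close>

text \<open>Completing the square, with the residual scaled by \<open>sqrt \<alpha>\<close> and the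
  multiplier by its inverse. The subtracted term is free of the residual and cancels when values of
  the augmented Lagrangian are compared at fixed multipliers.\<close>

lemma augmented_term_eq:
  fixes r v :: "'a::real_inner"
  assumes "\<alpha> > 0"
  shows "v \<bullet> r + (\<alpha> / 2) * (norm r)\<^sup>2 =
    (1/2) * (norm (sqrt \<alpha> *\<^sub>R r + (1 / sqrt \<alpha>) *\<^sub>R v))\<^sup>2 - (1/2) * (norm ((1 / sqrt \<alpha>) *\<^sub>R v))\<^sup>2"
proof -
  have "(norm (sqrt \<alpha> *\<^sub>R r + (1 / sqrt \<alpha>) *\<^sub>R v))\<^sup>2
      = \<alpha> * (norm r)\<^sup>2 + 2 * (v \<bullet> r) + (norm ((1 / sqrt \<alpha>) *\<^sub>R v))\<^sup>2"
    unfolding power2_norm_eq_inner using assms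
    by (simp add: inner_add_left inner_add_right inner_commute)
  then show ?thesis by (simp only:) (simp add: field_simps)
qed

lemma power2_norm_Pair: "(norm (u, v))\<^sup>2 = (norm u)\<^sup>2 + (norm v)\<^sup>2"
  by (simp add: norm_Pair)

lemma sum_Basis_prod: "(\<Sum>e\<in>Basis. h e) = (\<Sum>e\<in>Basis. h (e, 0)) + (\<Sum>e\<in>Basis. h (0, e))"
proof -
  have inj: "inj_on (\<lambda>u. (u, 0)) Basis" "inj_on (Pair 0) Basis" by (auto intro!: inj_onI)
  show ?thesis
    unfolding Basis_prod_def by (subst sum.union_disjoint) (auto simp: sum.reindex inj)
qed

lemma sum_Basis_matrix: "(\<Sum>e\<in>(Basis :: (real^'c^'r) set). h e) = (\<Sum>i\<in>UNIV. \<Sum>j\<in>UNIV. h (axis i (axis j 1)))"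
proof -
  have B: "(Basis :: (real^'c^'r) set) = (\<lambda>(i, j). axis i (axis j 1)) ` (UNIV \<times> UNIV)"
    by (auto simp: Basis_vec_def)
  have inj: "inj_on (\<lambda>(i :: 'r, j :: 'c). axis i (axis j (1::real))) (UNIV \<times> UNIV)"
    by (auto simp: inj_on_def axis_eq_axis)
  show ?thesis unfolding B sum.reindex[OF inj] by (simp add: sum.cartesian_product case_prod_beta o_def)
qed

section \<open>Instances for (P1) and (P2)\<close>

text \<open>\<open>x\<close> bundles \<open>W\<close> with \<open>b\<close>, and \<open>w\<close>
  bundles the copies \<open>A\<close> and \<open>U\<close>, so the alternation is that of the
  \<open>admm\<close> locale. The two penalties differ, which the block scalings \<open>a\<close>
  and \<open>m\<close> absorb.\<close>

theorem svm_admm_elastic_net: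
  fixes X :: "real ^ ('n::finite) ^ ('p::finite)" and y :: "'n \<Rightarrow> ('J::finite)"
    and W :: "nat \<Rightarrow> real ^ 'J ^ 'p" and b :: "nat \<Rightarrow> real ^ 'J"
    and A :: "nat \<Rightarrow> real ^ 'J ^ 'n" and U :: "nat \<Rightarrow> real ^ 'J ^ 'p"
    and P :: "nat \<Rightarrow> real ^ 'J ^ 'n" and Lam :: "nat \<Rightarrow> real ^ 'J ^ 'p"
  assumes lam: "l1 \<ge> 0" "l2 \<ge> 0" "l3 > 0" and pen: "\<alpha> > 0" "\<mu> > 0"
    and step_Wb: "\<And>k. (W (Suc k), b (Suc k)) \<in> Dset \<and>
        (\<forall>W' b'. (W', b') \<in> Dset \<longrightarrow>
           L1 X y l1 l2 l3 \<alpha> \<mu> (W (Suc k)) (b (Suc k)) (A k) (U k) (P k) (Lam k)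
           \<le> L1 X y l1 l2 l3 \<alpha> \<mu> W' b' (A k) (U k) (P k) (Lam k))"
    and step_AU: "\<And>k A' U'.
           L1 X y l1 l2 l3 \<alpha> \<mu> (W (Suc k)) (b (Suc k)) (A (Suc k)) (U (Suc k)) (P k) (Lam k)
           \<le> L1 X y l1 l2 l3 \<alpha> \<mu> (W (Suc k)) (b (Suc k)) A' U' (P k) (Lam k)"
    and step_P: "\<And>k. P (Suc k) = P k + \<alpha> *\<^sub>R resid X (W (Suc k)) (b (Suc k)) (A (Suc k))"
    and step_Lam: "\<And>k. Lam (Suc k) = Lam k + \<mu> *\<^sub>R (W (Suc k) - U (Suc k))"
  shows "(\<lambda>k. F1 y l1 l2 l3 (W k) (b k) (A k) (U k)) \<longlonglongrightarrow> opt1 X y l1 l2 l3"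
    and "(\<lambda>k. norm (resid X (W k) (b k) (A k))) \<longlonglongrightarrow> 0"
    and "(\<lambda>k. norm (W k - U k)) \<longlonglongrightarrow> 0"
    and "linearly_convergent (\<lambda>k. (W k, b k, A k, U k, P k, Lam k))"
proof -
  define a where "a = sqrt \<alpha>"
  define m where "m = sqrt \<mu>"
  have a: "a > 0" "a * a = \<alpha>" and m: "m > 0" "m * m = \<mu>" using pen by (auto simp: a_def m_def)
  define M where "M x = (a *\<^sub>R (transpose X ** fst x + ebT (snd x)), m *\<^sub>R fst x)" for x :: "(real^'J^'p) \<times> (real^'J)"
  define c where "c = (a *\<^sub>R (ones_mat :: real^'J^'n), 0 :: real^'J^'p)"
  define f where "f x = (l2 / 2) * (norm (fst x))\<^sup>2 + (l3 / 2) * (norm (snd x))\<^sup>2" for x :: "(real^'J^'p) \<times> (real^'J)"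
  define g where "g w = hinge_loss y ((1 / a) *\<^sub>R fst w) + l1 * l1_mat ((1 / m) *\<^sub>R snd w)"
    for w :: "(real^'J^'n) \<times> (real^'J^'p)"
  define x where "x k = (W k, b k)" for k
  define w where "w k = (a *\<^sub>R A k, m *\<^sub>R U k)" for k
  define l where "l k = ((1 / a) *\<^sub>R P k, (1 / m) *\<^sub>R Lam k)" for k
  have F1_eq: "F1 y l1 l2 l3 W' b' A' U' = f (W', b') + g (a *\<^sub>R A', m *\<^sub>R U')" for W' b' A' U'
    using a m by (simp add: F1_def f_def g_def)
  have res: "M (W', b') + c - (a *\<^sub>R A', m *\<^sub>R U') = (a *\<^sub>R resid X W' b' A', m *\<^sub>R (W' - U'))" for W' b' A' U'
    by (simp add: M_def c_def resid_def algebra_simps)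
  have L1_eq: "L1 X y l1 l2 l3 \<alpha> \<mu> W' b' A' U' P' Lam' = f (W', b') + g (a *\<^sub>R A', m *\<^sub>R U')
      + (1/2) * (norm (M (W', b') + c - (a *\<^sub>R A', m *\<^sub>R U') + ((1 / a) *\<^sub>R P', (1 / m) *\<^sub>R Lam')))\<^sup>2
      - (1/2) * (norm ((1 / a) *\<^sub>R P', (1 / m) *\<^sub>R Lam'))\<^sup>2" for W' b' A' U' P' Lam'
    using augmented_term_eq[OF pen(1), of P' "resid X W' b' A'"] augmented_term_eq[OF pen(2), of Lam' "W' - U'"]
    unfolding L1_def F1_eq res add_Pair power2_norm_Pair a_def[symmetric] m_def[symmetric] distrib_left by linarith
  \<comment> \<open>The scaling is onto, so minimality over all \<open>A'\<close> and
    \<open>U'\<close> is minimality over the whole product space.\<close>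
  have surj: "v = (a *\<^sub>R ((1 / a) *\<^sub>R fst v), m *\<^sub>R ((1 / m) *\<^sub>R snd v))" for v :: "(real^'J^'n) \<times> (real^'J^'p)"
    using a m by simp
  have linM: "linear M"
    by (rule linearI)
      (auto simp: M_def linear_add[OF linear_matrix_mult_left] linear_cmul[OF linear_matrix_mult_left]
        linear_add[OF linear_ebT] linear_cmul[OF linear_ebT] algebra_simps)
  have f: "convex_on UNIV f"
    unfolding f_def
    by (intro convex_on_add convex_on_cmul convex_on_compose_linear[OF convex_on_norm_square linear_fst]
        convex_on_compose_linear[OF convex_on_norm_square linear_snd]) (use lam in auto)
  have g: "convex_on UNIV g"
    unfolding g_def
    by (intro convex_on_add convex_on_cmul convex_on_compose_linear[OF hinge_loss_convex]
        convex_on_compose_linear[OF l1_mat_convex])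
      (use lam in \<open>auto intro!: linear_compose_scale_right linear_fst linear_snd\<close>)
  have fD: "convex_on Dset f" using f by (rule convex_on_subset) (auto simp: subspace_imp_convex subspace_Dset)
  have admm: "admm M c Dset f g x w l"
  proof (rule admm.intro)
    show "linear M" by (rule linM)
    show "convex Dset" by (simp add: subspace_imp_convex subspace_Dset)
    show "convex_on Dset f" by (rule fD)
    show "convex_on UNIV g" by (rule g)
    show "x (Suc k) \<in> Dset" for k using step_Wb by (simp add: x_def)
    show "f (x (Suc k)) + (1/2) * (norm (M (x (Suc k)) + c - w k + l k))\<^sup>2
        \<le> f z + (1/2) * (norm (M z + c - w k + l k))\<^sup>2" if "z \<in> Dset" for k z
    proof -
      obtain W' b' where z: "z = (W', b')" by (cases z)
      have "(W', b') \<in> Dset" using that z by simp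
      then have "L1 X y l1 l2 l3 \<alpha> \<mu> (W (Suc k)) (b (Suc k)) (A k) (U k) (P k) (Lam k)
           \<le> L1 X y l1 l2 l3 \<alpha> \<mu> W' b' (A k) (U k) (P k) (Lam k)" using step_Wb by blast
      then show ?thesis unfolding L1_eq x_def w_def l_def z by linarith
    qed
    show "g (w (Suc k)) + (1/2) * (norm (M (x (Suc k)) + c - w (Suc k) + l k))\<^sup>2
        \<le> g v + (1/2) * (norm (M (x (Suc k)) + c - v + l k))\<^sup>2" for k v
      using step_AU[of k "(1 / a) *\<^sub>R fst v" "(1 / m) *\<^sub>R snd v"]
      unfolding L1_eq surj[of v, symmetric] x_def w_def l_def by linarith
    show "l (Suc k) = l k + (M (x (Suc k)) + c - w (Suc k))" for k
    proof -
      have "(1 / a) * \<alpha> = a" "(1 / m) * \<mu> = m" using a m by (auto simp flip: a(2) m(2))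
      then show ?thesis unfolding x_def w_def l_def res step_P step_Lam by (simp add: scaleR_add_right)
    qed
  qed
  then interpret admm M c Dset f g x w l .
  define R where "R W' = l1 * l1_mat W' + (l2 / 2) * (norm W')\<^sup>2" for W' :: "real^'J^'p"
  define \<Phi> where "\<Phi> W' b' = hinge_loss y (transpose X ** W' + ebT b' + ones_mat) + R W' + (l3 / 2) * (norm b')\<^sup>2" for W' b'
  have R1: "convex_on UNIV R"
    unfolding R_def by (intro convex_on_add convex_on_cmul l1_mat_convex convex_on_norm_square) (use lam in auto)
  have R2: "R W' \<ge> 0" for W' unfolding R_def using lam l1_mat_nonneg[of W'] by simp
  \<comment> \<open>\<open>W\<close> is either not penalised at all or the penalty grows at least
    linearly, the quadratic one after subtracting a constant.\<close>
  have R3: "(\<forall>W'. R W' = 0) \<or> (\<exists>e>0. \<forall>W'. e * norm W' - e \<le> R W')"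
  proof -
    consider "l1 = 0 \<and> l2 = 0" | "l1 > 0" | "l2 > 0" using lam by linarith
    then show ?thesis
    proof cases
      case 1
      then show ?thesis by (simp add: R_def)
    next
      case 2
      have "l1 * norm W' - l1 \<le> R W'" for W'
      proof -
        have "l1 * norm W' \<le> l1 * l1_mat W'" using 2 norm_le_l1_mat by (intro mult_left_mono) auto
        moreover have "0 \<le> (l2 / 2) * (norm W')\<^sup>2" using lam by simp
        ultimately show ?thesis using 2 unfolding R_def by linarith
      qed
      then show ?thesis using 2 by blast
    next
      case 3
      have "(l2 / 2) * norm W' - l2 / 2 \<le> R W'" for W'
      proof -
        have "norm W' - 1 \<le> (norm W')\<^sup>2"
          using sum_squares_ge_zero[of "norm W' - 1" 0] norm_ge_zero[of W']
          unfolding power2_eq_square by (simp add: algebra_simps del: norm_ge_zero)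
        then have "(l2 / 2) * (norm W' - 1) \<le> (l2 / 2) * (norm W')\<^sup>2" using 3 by (intro mult_left_mono) auto
        moreover have "0 \<le> l1 * l1_mat W'" using lam l1_mat_nonneg[of W'] by simp
        ultimately show ?thesis unfolding R_def right_diff_distrib mult_1_right by linarith
      qed
      then show ?thesis using 3 by (intro disjI2 exI[of _ "l2 / 2"]) auto
    qed
  qed
  obtain Ws bs where Ds: "(Ws, bs) \<in> Dset" and min: "\<And>W' b'. (W', b') \<in> Dset \<Longrightarrow> \<Phi> Ws bs \<le> \<Phi> W' b'"
    using svm_minimizer_exists[OF lam(3) R1 R2 R3, of y X] unfolding \<Phi>_def by blast
  have feas: "M (W', b') + c = (a *\<^sub>R (transpose X ** W' + ebT b' + ones_mat), m *\<^sub>R W')" for W' b'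
    by (simp add: M_def c_def scaleR_add_right)
  have obj: "f (W', b') + g (M (W', b') + c) = \<Phi> W' b'" for W' b'
    unfolding feas using a m by (simp add: f_def g_def \<Phi>_def R_def)
  have "f (Ws, bs) + g (M (Ws, bs) + c) \<le> f z + g (M z + c)" if "z \<in> Dset" for z
    using min that obj by (cases z) auto
  then obtain ls where ls: "saddle (Ws, bs) ls" using saddle_exists[OF Ds] by blast
  have opt: "opt1 X y l1 l2 l3 = f (Ws, bs) + g (M (Ws, bs) + c)"
    unfolding opt1_def
  proof (rule cInf_eq_minimum)
    have "f (Ws, bs) + g (M (Ws, bs) + c) = F1 y l1 l2 l3 Ws bs (transpose X ** Ws + ebT bs + ones_mat) Ws"
      unfolding F1_eq feas ..
    then show "f (Ws, bs) + g (M (Ws, bs) + c) \<in> {F1 y l1 l2 l3 W b A U |W b A U.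
        A = transpose X ** W + ebT b + ones_mat \<and> U = W \<and> (W, b) \<in> Dset}"
      using Ds by blast
  next
    fix v assume "v \<in> {F1 y l1 l2 l3 W b A U |W b A U.
        A = transpose X ** W + ebT b + ones_mat \<and> U = W \<and> (W, b) \<in> Dset}"
    then obtain W' b' where D: "(W', b') \<in> Dset"
      and v: "v = F1 y l1 l2 l3 W' b' (transpose X ** W' + ebT b' + ones_mat) W'" by blast
    have "v = \<Phi> W' b'" unfolding v F1_eq feas[symmetric] by (rule obj)
    then show "f (Ws, bs) + g (M (Ws, bs) + c) \<le> v" using min[OF D] obj[of Ws bs] by simp
  qed
  show "(\<lambda>k. F1 y l1 l2 l3 (W k) (b k) (A k) (U k)) \<longlonglongrightarrow> opt1 X y l1 l2 l3"
    using objective_tendsto[OF ls] unfolding opt F1_eq x_def w_def .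
  have rt: "(\<lambda>k. (a *\<^sub>R resid X (W k) (b k) (A k), m *\<^sub>R (W k - U k))) \<longlonglongrightarrow> 0"
    using residual_tendsto[OF ls] unfolding x_def w_def res .
  have "(\<lambda>k. (1 / a) *\<^sub>R (a *\<^sub>R resid X (W k) (b k) (A k))) \<longlonglongrightarrow> (1 / a) *\<^sub>R 0"
    using tendsto_fst[OF rt] by (intro tendsto_intros) simp
  then show "(\<lambda>k. norm (resid X (W k) (b k) (A k))) \<longlonglongrightarrow> 0" using a by (simp add: tendsto_norm_zero_iff)
  have "(\<lambda>k. (1 / m) *\<^sub>R (m *\<^sub>R (W k - U k))) \<longlonglongrightarrow> (1 / m) *\<^sub>R 0"
    using tendsto_snd[OF rt] by (intro tendsto_intros) simp
  then show "(\<lambda>k. norm (W k - U k)) \<longlonglongrightarrow> 0" using m by (simp add: tendsto_norm_zero_iff)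
  define Q where "Q x = (l2 *\<^sub>R fst x, l3 *\<^sub>R snd x)" for x :: "(real^'J^'p) \<times> (real^'J)"
  \<comment> \<open>The extreme slopes of \<open>g\<close>: the hinge term ranges from 0 to its
    weight, the absolute value between opposite slopes; the divisions by \<open>a\<close> and
    \<open>m\<close> stem from the rescaling.\<close>
  define hi where "hi = ((\<chi> i j. cost y i j / (real CARD('n) * a)) :: real^'J^'n, (l1 / m) *\<^sub>R (ones_mat :: real^'J^'p))"
  define lo where "lo = (0 :: real^'J^'n, - (l1 / m) *\<^sub>R (ones_mat :: real^'J^'p))"
  have "admm_quadratic_polyhedral M c Dset f g x w l Q lo hi"
  proof (rule admm_quadratic_polyhedral.intro[OF admm admm_quadratic_polyhedral_axioms.intro])
    \<comment> \<open>The second block determines \<open>W\<close>; the first then determines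
      \<open>b\<close>, because every row of \<open>ebT b\<close> is \<open>b\<close>.\<close>
    show "inj M"
      unfolding linear_injective_0[OF linM]
    proof (intro allI impI)
      fix z assume "M z = 0"
      then have "fst z = 0" "ebT (snd z) = (0 :: real^'J^'n)" using a m by (auto simp: M_def zero_prod_def)
      moreover from this(2) have "snd z = 0" by (auto simp: ebT_def vec_eq_iff)
      ultimately show "z = 0" by (simp add: prod_eq_iff)
    qed
    show "subspace Dset" by (rule subspace_Dset)
    show "linear Q" by (rule linearI) (auto simp: Q_def algebra_simps)
    show "Q u \<bullet> v = u \<bullet> Q v" for u v by (simp add: Q_def inner_prod_def)
    show "0 \<le> Q u \<bullet> u" for u using lam by (simp add: Q_def inner_prod_def)
    show "f z = 1 / 2 * (Q z \<bullet> z)" for z by (simp add: f_def Q_def inner_prod_def power2_norm_eq_inner)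
    show "lo \<bullet> e \<le> hi \<bullet> e" if "e \<in> Basis" for e
    proof -
      have "e \<in> (\<lambda>u. (u, 0)) ` Basis \<union> (\<lambda>u. (0, u)) ` Basis" using that by (simp add: Basis_prod_def)
      then show ?thesis
        using lam a m by (auto simp: Basis_vec_def lo_def hi_def inner_axis ones_mat_def cost_nonneg)
    qed
    show "g v = (\<Sum>e\<in>Basis. max (lo \<bullet> e * (v \<bullet> e)) (hi \<bullet> e * (v \<bullet> e)))" for v
    proof -
      have 1: "max 0 (cost y i j / (real CARD('n) * a) * t) = (1 / real CARD('n)) * (cost y i j * pos_part ((1 / a) * t))" for i j t
      proof -
        have "cost y i j / (real CARD('n) * a) \<ge> 0" using a by (simp add: cost_nonneg)
        from pos_part_mult[OF this, of t] pos_part_mult[of "1 / a" t] show ?thesis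
          using a by (simp add: pos_part_def)
      qed
      have 2: "max (- (l1 / m) * t) ((l1 / m) * t) = l1 * \<bar>(1 / m) * t\<bar>" for t
      proof -
        have "max (- (l1 / m) * t) ((l1 / m) * t) = \<bar>(l1 / m) * t\<bar>" by (simp add: abs_if max_def)
        also have "\<dots> = l1 * \<bar>(1 / m) * t\<bar>" using lam m by (simp add: abs_mult)
        finally show ?thesis .
      qed
      show ?thesis
        unfolding sum_Basis_prod sum_Basis_matrix
        using 1 2
        by (simp add: lo_def hi_def inner_axis ones_mat_def g_def hinge_loss_def l1_mat_def sum_distrib_left inner_prod_def)
    qed
  qed
  then interpret admm_quadratic_polyhedral M c Dset f g x w l Q lo hi .
  note lc = iterates_linearly_convergent[OF ls]
  have unscale: "linearly_convergent (\<lambda>k. s *\<^sub>R T (z k))"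
    if "linearly_convergent z" "bounded_linear T" for s :: real and T :: "'u::real_normed_vector \<Rightarrow> 'v::real_normed_vector" and z
    by (rule linearly_convergent_bounded_linear[OF bounded_linear_const_scaleR[OF that(2)] that(1)])
  have "linearly_convergent W" "linearly_convergent b"
    using linearly_convergent_bounded_linear[OF bounded_linear_fst lc(1)]
      linearly_convergent_bounded_linear[OF bounded_linear_snd lc(1)] by (simp_all add: x_def)
  moreover have "linearly_convergent A" "linearly_convergent U"
    using unscale[OF lc(2) bounded_linear_fst, of "1 / a"] unscale[OF lc(2) bounded_linear_snd, of "1 / m"] a m
    by (simp_all add: w_def)
  moreover have "linearly_convergent P" "linearly_convergent Lam"
    using unscale[OF lc(3) bounded_linear_fst, of a] unscale[OF lc(3) bounded_linear_snd, of m] a m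
    by (simp_all add: l_def)
  ultimately show "linearly_convergent (\<lambda>k. (W k, b k, A k, U k, P k, Lam k))"
    by (intro linearly_convergent_Pair)
qed

text \<open>A third block carries the copy \<open>V\<close>. The row norms act on that copy and so
  belong to \<open>g\<close>, which leaves only the penalty on \<open>b\<close> in
  \<open>f\<close>.\<close>

theorem svm_admm_group_lasso:
  fixes X :: "real ^ ('n::finite) ^ ('p::finite)" and y :: "'n \<Rightarrow> ('J::finite)"
    and W :: "nat \<Rightarrow> real ^ 'J ^ 'p" and b :: "nat \<Rightarrow> real ^ 'J"
    and A :: "nat \<Rightarrow> real ^ 'J ^ 'n" and U V :: "nat \<Rightarrow> real ^ 'J ^ 'p"
    and P :: "nat \<Rightarrow> real ^ 'J ^ 'n" and Lam Gam :: "nat \<Rightarrow> real ^ 'J ^ 'p"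
  assumes lam: "l1 \<ge> 0" "l2 \<ge> 0" "l3 > 0" and q: "q = 2 \<or> q = \<infinity>" and pen: "\<alpha> > 0" "\<mu> > 0" "\<nu> > 0"
    and step_Wb: "\<And>k. (W (Suc k), b (Suc k)) \<in> Dset \<and>
        (\<forall>W' b'. (W', b') \<in> Dset \<longrightarrow>
           L2 q X y l1 l2 l3 \<alpha> \<mu> \<nu> (W (Suc k)) (b (Suc k)) (A k) (U k) (V k) (P k) (Lam k) (Gam k)
           \<le> L2 q X y l1 l2 l3 \<alpha> \<mu> \<nu> W' b' (A k) (U k) (V k) (P k) (Lam k) (Gam k))"
    and step_AUV: "\<And>k A' U' V'.
           L2 q X y l1 l2 l3 \<alpha> \<mu> \<nu> (W (Suc k)) (b (Suc k)) (A (Suc k)) (U (Suc k)) (V (Suc k)) (P k) (Lam k) (Gam k)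
           \<le> L2 q X y l1 l2 l3 \<alpha> \<mu> \<nu> (W (Suc k)) (b (Suc k)) A' U' V' (P k) (Lam k) (Gam k)"
    and step_P: "\<And>k. P (Suc k) = P k + \<alpha> *\<^sub>R resid X (W (Suc k)) (b (Suc k)) (A (Suc k))"
    and step_Lam: "\<And>k. Lam (Suc k) = Lam k + \<mu> *\<^sub>R (W (Suc k) - U (Suc k))"
    and step_Gam: "\<And>k. Gam (Suc k) = Gam k + \<nu> *\<^sub>R (W (Suc k) - V (Suc k))"
  shows "(\<lambda>k. F2 q y l1 l2 l3 (W k) (b k) (A k) (U k) (V k)) \<longlonglongrightarrow> opt2 q X y l1 l2 l3"
    and "(\<lambda>k. norm (resid X (W k) (b k) (A k))) \<longlonglongrightarrow> 0"
    and "(\<lambda>k. norm (W k - U k)) \<longlonglongrightarrow> 0"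
    and "(\<lambda>k. norm (W k - V k)) \<longlonglongrightarrow> 0"
proof -
  define a where "a = sqrt \<alpha>"
  define m where "m = sqrt \<mu>"
  define n where "n = sqrt \<nu>"
  have a: "a > 0" "a * a = \<alpha>" and m: "m > 0" "m * m = \<mu>" and n: "n > 0" "n * n = \<nu>"
    using pen by (auto simp: a_def m_def n_def)
  define N where "N V' = (\<Sum>i\<in>UNIV. lq_norm q (V' $ i))" for V' :: "real^'J^'p"
  define M where "M x = (a *\<^sub>R (transpose X ** fst x + ebT (snd x)), m *\<^sub>R fst x, n *\<^sub>R fst x)"
    for x :: "(real^'J^'p) \<times> (real^'J)"
  define c where "c = (a *\<^sub>R (ones_mat :: real^'J^'n), 0 :: real^'J^'p, 0 :: real^'J^'p)"
  define f where "f x = (l3 / 2) * (norm (snd x))\<^sup>2" for x :: "(real^'J^'p) \<times> (real^'J)"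
  define g where "g w = hinge_loss y ((1 / a) *\<^sub>R fst w) + l1 * l1_mat ((1 / m) *\<^sub>R fst (snd w))
      + l2 * N ((1 / n) *\<^sub>R snd (snd w))"
    for w :: "(real^'J^'n) \<times> (real^'J^'p) \<times> (real^'J^'p)"
  define x where "x k = (W k, b k)" for k
  define w where "w k = (a *\<^sub>R A k, m *\<^sub>R U k, n *\<^sub>R V k)" for k
  define l where "l k = ((1 / a) *\<^sub>R P k, (1 / m) *\<^sub>R Lam k, (1 / n) *\<^sub>R Gam k)" for k
  have F2_eq: "F2 q y l1 l2 l3 W' b' A' U' V' = f (W', b') + g (a *\<^sub>R A', m *\<^sub>R U', n *\<^sub>R V')" for W' b' A' U' V'
    using a m n by (simp add: F2_def f_def g_def N_def)
  have res: "M (W', b') + c - (a *\<^sub>R A', m *\<^sub>R U', n *\<^sub>R V')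
      = (a *\<^sub>R resid X W' b' A', m *\<^sub>R (W' - U'), n *\<^sub>R (W' - V'))" for W' b' A' U' V'
    by (simp add: M_def c_def resid_def algebra_simps)
  have L2_eq: "L2 q X y l1 l2 l3 \<alpha> \<mu> \<nu> W' b' A' U' V' P' Lam' Gam' = f (W', b') + g (a *\<^sub>R A', m *\<^sub>R U', n *\<^sub>R V')
      + (1/2) * (norm (M (W', b') + c - (a *\<^sub>R A', m *\<^sub>R U', n *\<^sub>R V')
          + ((1 / a) *\<^sub>R P', (1 / m) *\<^sub>R Lam', (1 / n) *\<^sub>R Gam')))\<^sup>2
      - (1/2) * (norm ((1 / a) *\<^sub>R P', (1 / m) *\<^sub>R Lam', (1 / n) *\<^sub>R Gam'))\<^sup>2" for W' b' A' U' V' P' Lam' Gam'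
    using augmented_term_eq[OF pen(1), of P' "resid X W' b' A'"] augmented_term_eq[OF pen(2), of Lam' "W' - U'"]
      augmented_term_eq[OF pen(3), of Gam' "W' - V'"]
    unfolding L2_def F2_eq res add_Pair power2_norm_Pair a_def[symmetric] m_def[symmetric] n_def[symmetric] distrib_left
    by linarith
  have surj: "v = (a *\<^sub>R ((1 / a) *\<^sub>R fst v), m *\<^sub>R ((1 / m) *\<^sub>R fst (snd v)), n *\<^sub>R ((1 / n) *\<^sub>R snd (snd v)))"
    for v :: "(real^'J^'n) \<times> (real^'J^'p) \<times> (real^'J^'p)"
    using a m n by simp
  have linM: "linear M"
    by (rule linearI)
      (auto simp: M_def linear_add[OF linear_matrix_mult_left] linear_cmul[OF linear_matrix_mult_left]
        linear_add[OF linear_ebT] linear_cmul[OF linear_ebT] algebra_simps)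
  have lin_snd2: "linear (\<lambda>v :: (real^'J^'n) \<times> (real^'J^'p) \<times> (real^'J^'p). fst (snd v))"
    "linear (\<lambda>v :: (real^'J^'n) \<times> (real^'J^'p) \<times> (real^'J^'p). snd (snd v))"
    by (auto intro!: linearI)
  have N: "convex_on UNIV N"
    unfolding N_def
    by (intro convex_on_sum_functions convex_on_compose_linear[OF lq_norm_convex[OF q]]) (auto intro!: linearI)
  have f: "convex_on UNIV f"
    unfolding f_def
    by (intro convex_on_cmul convex_on_compose_linear[OF convex_on_norm_square linear_snd]) (use lam in auto)
  have g: "convex_on UNIV g"
    unfolding g_def
    by (intro convex_on_add convex_on_cmul convex_on_compose_linear[OF hinge_loss_convex]
        convex_on_compose_linear[OF l1_mat_convex] convex_on_compose_linear[OF N])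
      (use lam in \<open>auto intro!: linear_compose_scale_right linear_fst lin_snd2\<close>)
  have fD: "convex_on Dset f" using f by (rule convex_on_subset) (auto simp: subspace_imp_convex subspace_Dset)
  have "admm M c Dset f g x w l"
  proof (rule admm.intro)
    show "linear M" by (rule linM)
    show "convex Dset" by (simp add: subspace_imp_convex subspace_Dset)
    show "convex_on Dset f" by (rule fD)
    show "convex_on UNIV g" by (rule g)
    show "x (Suc k) \<in> Dset" for k using step_Wb by (simp add: x_def)
    show "f (x (Suc k)) + (1/2) * (norm (M (x (Suc k)) + c - w k + l k))\<^sup>2
        \<le> f z + (1/2) * (norm (M z + c - w k + l k))\<^sup>2" if "z \<in> Dset" for k z
    proof -
      obtain W' b' where z: "z = (W', b')" by (cases z)
      have "(W', b') \<in> Dset" using that z by simp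
      then have "L2 q X y l1 l2 l3 \<alpha> \<mu> \<nu> (W (Suc k)) (b (Suc k)) (A k) (U k) (V k) (P k) (Lam k) (Gam k)
           \<le> L2 q X y l1 l2 l3 \<alpha> \<mu> \<nu> W' b' (A k) (U k) (V k) (P k) (Lam k) (Gam k)" using step_Wb by blast
      then show ?thesis unfolding L2_eq x_def w_def l_def z by linarith
    qed
    show "g (w (Suc k)) + (1/2) * (norm (M (x (Suc k)) + c - w (Suc k) + l k))\<^sup>2
        \<le> g v + (1/2) * (norm (M (x (Suc k)) + c - v + l k))\<^sup>2" for k v
      using step_AUV[of k "(1 / a) *\<^sub>R fst v" "(1 / m) *\<^sub>R fst (snd v)" "(1 / n) *\<^sub>R snd (snd v)"]
      unfolding L2_eq surj[of v, symmetric] x_def w_def l_def by linarith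
    show "l (Suc k) = l k + (M (x (Suc k)) + c - w (Suc k))" for k
    proof -
      have "(1 / a) * \<alpha> = a" "(1 / m) * \<mu> = m" "(1 / n) * \<nu> = n" using a m n by (auto simp flip: a(2) m(2) n(2))
      then show ?thesis unfolding x_def w_def l_def res step_P step_Lam step_Gam by (simp add: scaleR_add_right)
    qed
  qed
  then interpret admm M c Dset f g x w l .
  define R where "R W' = l1 * l1_mat W' + l2 * N W'" for W'
  define \<Phi> where "\<Phi> W' b' = hinge_loss y (transpose X ** W' + ebT b' + ones_mat) + R W' + (l3 / 2) * (norm b')\<^sup>2" for W' b'
  \<comment> \<open>Besides convexity, this comparison is the only information about
    \<open>q\<close> that enters.\<close>
  have N_lower: "norm W' \<le> real CARD('J) * N W'" for W'
    unfolding N_def sum_distrib_left by (rule order_trans[OF norm_le_sum_rows sum_mono[OF norm_le_lq_norm[OF q]]])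
  have N_nonneg: "N W' \<ge> 0" for W'
  proof -
    have "0 \<le> real CARD('J) * N W'" using N_lower[of W'] norm_ge_zero[of W'] by linarith
    then show ?thesis by (simp add: zero_le_mult_iff)
  qed
  have R1: "convex_on UNIV R"
    unfolding R_def by (intro convex_on_add convex_on_cmul l1_mat_convex N) (use lam in auto)
  have R2: "R W' \<ge> 0" for W' unfolding R_def using lam l1_mat_nonneg[of W'] N_nonneg[of W'] by simp
  have R3: "(\<forall>W'. R W' = 0) \<or> (\<exists>e>0. \<forall>W'. e * norm W' - e \<le> R W')"
  proof -
    consider "l1 = 0 \<and> l2 = 0" | "l1 > 0" | "l2 > 0" using lam by linarith
    then show ?thesis
    proof cases
      case 1
      then show ?thesis by (simp add: R_def)
    next
      case 2
      have "l1 * norm W' - l1 \<le> R W'" for W'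
      proof -
        have "l1 * norm W' \<le> l1 * l1_mat W'" using 2 norm_le_l1_mat by (intro mult_left_mono) auto
        moreover have "0 \<le> l2 * N W'" using lam N_nonneg[of W'] by simp
        ultimately show ?thesis using 2 unfolding R_def by linarith
      qed
      then show ?thesis using 2 by blast
    next
      case 3
      define e where "e = l2 / real CARD('J)"
      have e: "e > 0" using 3 by (simp add: e_def)
      have "e * norm W' - e \<le> R W'" for W'
      proof -
        have "e * norm W' \<le> e * (real CARD('J) * N W')" using e N_lower by (intro mult_left_mono) auto
        also have "\<dots> = l2 * N W'" by (simp add: e_def)
        finally have "e * norm W' \<le> l2 * N W'" .
        moreover have "0 \<le> l1 * l1_mat W'" using lam l1_mat_nonneg[of W'] by simp
        ultimately show ?thesis using e unfolding R_def by linarith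
      qed
      then show ?thesis using e by blast
    qed
  qed
  obtain Ws bs where Ds: "(Ws, bs) \<in> Dset" and min: "\<And>W' b'. (W', b') \<in> Dset \<Longrightarrow> \<Phi> Ws bs \<le> \<Phi> W' b'"
    using svm_minimizer_exists[OF lam(3) R1 R2 R3, of y X] unfolding \<Phi>_def by blast
  have feas: "M (W', b') + c = (a *\<^sub>R (transpose X ** W' + ebT b' + ones_mat), m *\<^sub>R W', n *\<^sub>R W')" for W' b'
    by (simp add: M_def c_def scaleR_add_right)
  have obj: "f (W', b') + g (M (W', b') + c) = \<Phi> W' b'" for W' b'
    unfolding feas using a m n by (simp add: f_def g_def \<Phi>_def R_def)
  have "f (Ws, bs) + g (M (Ws, bs) + c) \<le> f z + g (M z + c)" if "z \<in> Dset" for z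
    using min that obj by (cases z) auto
  then obtain ls where ls: "saddle (Ws, bs) ls" using saddle_exists[OF Ds] by blast
  have opt: "opt2 q X y l1 l2 l3 = f (Ws, bs) + g (M (Ws, bs) + c)"
    unfolding opt2_def
  proof (rule cInf_eq_minimum)
    have "f (Ws, bs) + g (M (Ws, bs) + c) = F2 q y l1 l2 l3 Ws bs (transpose X ** Ws + ebT bs + ones_mat) Ws Ws"
      unfolding F2_eq feas ..
    then show "f (Ws, bs) + g (M (Ws, bs) + c) \<in> {F2 q y l1 l2 l3 W b A U V |W b A U V.
        A = transpose X ** W + ebT b + ones_mat \<and> U = W \<and> V = W \<and> (W, b) \<in> Dset}"
      using Ds by blast
  next
    fix v assume "v \<in> {F2 q y l1 l2 l3 W b A U V |W b A U V.
        A = transpose X ** W + ebT b + ones_mat \<and> U = W \<and> V = W \<and> (W, b) \<in> Dset}"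
    then obtain W' b' where D: "(W', b') \<in> Dset"
      and v: "v = F2 q y l1 l2 l3 W' b' (transpose X ** W' + ebT b' + ones_mat) W' W'" by blast
    have "v = \<Phi> W' b'" unfolding v F2_eq feas[symmetric] by (rule obj)
    then show "f (Ws, bs) + g (M (Ws, bs) + c) \<le> v" using min[OF D] obj[of Ws bs] by simp
  qed
  show "(\<lambda>k. F2 q y l1 l2 l3 (W k) (b k) (A k) (U k) (V k)) \<longlonglongrightarrow> opt2 q X y l1 l2 l3"
    using objective_tendsto[OF ls] unfolding opt F2_eq x_def w_def .
  have rt: "(\<lambda>k. (a *\<^sub>R resid X (W k) (b k) (A k), m *\<^sub>R (W k - U k), n *\<^sub>R (W k - V k))) \<longlonglongrightarrow> 0"
    using residual_tendsto[OF ls] unfolding x_def w_def res .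
  have "(\<lambda>k. (1 / a) *\<^sub>R (a *\<^sub>R resid X (W k) (b k) (A k))) \<longlonglongrightarrow> (1 / a) *\<^sub>R 0"
    using tendsto_fst[OF rt] by (intro tendsto_intros) simp
  then show "(\<lambda>k. norm (resid X (W k) (b k) (A k))) \<longlonglongrightarrow> 0" using a by (simp add: tendsto_norm_zero_iff)
  have "(\<lambda>k. (1 / m) *\<^sub>R (m *\<^sub>R (W k - U k))) \<longlonglongrightarrow> (1 / m) *\<^sub>R 0"
    using tendsto_fst[OF tendsto_snd[OF rt]] by (intro tendsto_intros) simp
  then show "(\<lambda>k. norm (W k - U k)) \<longlonglongrightarrow> 0" using m by (simp add: tendsto_norm_zero_iff)
  have "(\<lambda>k. (1 / n) *\<^sub>R (n *\<^sub>R (W k - V k))) \<longlonglongrightarrow> (1 / n) *\<^sub>R 0"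
    using tendsto_snd[OF tendsto_snd[OF rt]] by (intro tendsto_intros) simp
  then show "(\<lambda>k. norm (W k - V k)) \<longlonglongrightarrow> 0" using n by (simp add: tendsto_norm_zero_iff)
qed

theorem theorem1:
  fixes X :: "real ^ ('n::finite) ^ ('p::finite)" and y :: "'n \<Rightarrow> ('J::finite)"
    and l1 l2 l3 :: real and q :: ereal
    and \<alpha>1 \<mu>1 \<alpha>2 \<mu>2 \<nu> :: real
    and W1 :: "nat \<Rightarrow> real ^ 'J ^ 'p" and b1 :: "nat \<Rightarrow> real ^ 'J"
    and A1 :: "nat \<Rightarrow> real ^ 'J ^ 'n" and U1 :: "nat \<Rightarrow> real ^ 'J ^ 'p"
    and Pi1 :: "nat \<Rightarrow> real ^ 'J ^ 'n" and Lam1 :: "nat \<Rightarrow> real ^ 'J ^ 'p"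
    and W2 :: "nat \<Rightarrow> real ^ 'J ^ 'p" and b2 :: "nat \<Rightarrow> real ^ 'J"
    and A2 :: "nat \<Rightarrow> real ^ 'J ^ 'n" and U2 V2 :: "nat \<Rightarrow> real ^ 'J ^ 'p"
    and Pi2 :: "nat \<Rightarrow> real ^ 'J ^ 'n" and Lam2 Gam2 :: "nat \<Rightarrow> real ^ 'J ^ 'p"
  assumes dims: "CARD('n) \<ge> 2" "CARD('p) \<ge> 2" "CARD('J) \<ge> 2"
    and lam: "l1 \<ge> 0" "l2 \<ge> 0" "l3 > 0"
    and q: "q = 2 \<or> q = \<infinity>"
    and pen1: "\<alpha>1 > 0" "\<mu>1 > 0"
    and pen2: "\<alpha>2 > 0" "\<mu>2 > 0" "\<nu> > 0"
    \<comment> \<open>ADMM iterations for (P1)\<close>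
    and step1_Wb: "\<And>k. (W1 (Suc k), b1 (Suc k)) \<in> Dset \<and>
        (\<forall>W b. (W, b) \<in> Dset \<longrightarrow>
           L1 X y l1 l2 l3 \<alpha>1 \<mu>1 (W1 (Suc k)) (b1 (Suc k)) (A1 k) (U1 k) (Pi1 k) (Lam1 k)
           \<le> L1 X y l1 l2 l3 \<alpha>1 \<mu>1 W b (A1 k) (U1 k) (Pi1 k) (Lam1 k))"
    and step1_AU: "\<And>k A U.
           L1 X y l1 l2 l3 \<alpha>1 \<mu>1 (W1 (Suc k)) (b1 (Suc k)) (A1 (Suc k)) (U1 (Suc k)) (Pi1 k) (Lam1 k)
           \<le> L1 X y l1 l2 l3 \<alpha>1 \<mu>1 (W1 (Suc k)) (b1 (Suc k)) A U (Pi1 k) (Lam1 k)"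
    and step1_Pi: "\<And>k. Pi1 (Suc k) = Pi1 k + \<alpha>1 *\<^sub>R resid X (W1 (Suc k)) (b1 (Suc k)) (A1 (Suc k))"
    and step1_Lam: "\<And>k. Lam1 (Suc k) = Lam1 k + \<mu>1 *\<^sub>R (W1 (Suc k) - U1 (Suc k))"
    \<comment> \<open>ADMM iterations for (P2)\<close>
    and step2_Wb: "\<And>k. (W2 (Suc k), b2 (Suc k)) \<in> Dset \<and>
        (\<forall>W b. (W, b) \<in> Dset \<longrightarrow>
           L2 q X y l1 l2 l3 \<alpha>2 \<mu>2 \<nu> (W2 (Suc k)) (b2 (Suc k)) (A2 k) (U2 k) (V2 k) (Pi2 k) (Lam2 k) (Gam2 k)
           \<le> L2 q X y l1 l2 l3 \<alpha>2 \<mu>2 \<nu> W b (A2 k) (U2 k) (V2 k) (Pi2 k) (Lam2 k) (Gam2 k))"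
    and step2_AUV: "\<And>k A U V.
           L2 q X y l1 l2 l3 \<alpha>2 \<mu>2 \<nu> (W2 (Suc k)) (b2 (Suc k)) (A2 (Suc k)) (U2 (Suc k)) (V2 (Suc k))
              (Pi2 k) (Lam2 k) (Gam2 k)
           \<le> L2 q X y l1 l2 l3 \<alpha>2 \<mu>2 \<nu> (W2 (Suc k)) (b2 (Suc k)) A U V (Pi2 k) (Lam2 k) (Gam2 k)"
    and step2_Pi: "\<And>k. Pi2 (Suc k) = Pi2 k + \<alpha>2 *\<^sub>R resid X (W2 (Suc k)) (b2 (Suc k)) (A2 (Suc k))"
    and step2_Lam: "\<And>k. Lam2 (Suc k) = Lam2 k + \<mu>2 *\<^sub>R (W2 (Suc k) - U2 (Suc k))"
    and step2_Gam: "\<And>k. Gam2 (Suc k) = Gam2 k + \<nu> *\<^sub>R (W2 (Suc k) - V2 (Suc k))"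
  shows "(\<lambda>k. F1 y l1 l2 l3 (W1 k) (b1 k) (A1 k) (U1 k)) \<longlonglongrightarrow> opt1 X y l1 l2 l3
    \<and> (\<lambda>k. F2 q y l1 l2 l3 (W2 k) (b2 k) (A2 k) (U2 k) (V2 k)) \<longlonglongrightarrow> opt2 q X y l1 l2 l3
    \<and> (\<lambda>k. norm (resid X (W1 k) (b1 k) (A1 k))) \<longlonglongrightarrow> 0
    \<and> (\<lambda>k. norm (W1 k - U1 k)) \<longlonglongrightarrow> 0
    \<and> (\<lambda>k. norm (resid X (W2 k) (b2 k) (A2 k))) \<longlonglongrightarrow> 0
    \<and> (\<lambda>k. norm (W2 k - U2 k)) \<longlonglongrightarrow> 0
    \<and> (\<lambda>k. norm (W2 k - V2 k)) \<longlonglongrightarrow> 0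
    \<and> (l2 > 0 \<longrightarrow>
        (\<exists>zstar C r. 0 \<le> r \<and> r < 1 \<and>
          (\<forall>k. norm ((W1 k, b1 k, A1 k, U1 k, Pi1 k, Lam1 k) - zstar) \<le> C * r ^ k)))"
proof -
  note P1 = svm_admm_elastic_net[where W = W1 and b = b1 and A = A1 and U = U1 and P = Pi1 and Lam = Lam1,
      OF lam pen1 step1_Wb step1_AU step1_Pi step1_Lam]
  note P2 = svm_admm_group_lasso[where W = W2 and b = b2 and A = A2 and U = U2 and V = V2 and P = Pi2
      and Lam = Lam2 and Gam = Gam2, OF lam q pen2 step2_Wb step2_AUV step2_Pi step2_Lam step2_Gam]
  show ?thesis using P1 P2 unfolding linearly_convergent_def by simp
qed

end
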